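(* Let $\mathcal{H}$ be a Hilbert space, let $F\colon \mathcal{H}\rightrightarrows\mathcal{H}$ be a set-valued mapping, let $(\bar x,\bar y)\in \operatorname{gph} F$, and let $\kappa>0$. The following assertions are equivalent: (a) $F$ is strongly locally maximal monotone at $(\bar x,\bar y)$ with modulus $\kappa$. (b) $DF$ is $\kappa$-lower-definite around $(\bar x,\bar y)$ and $F$ is locally maximal hypomonotone at $(\bar x,\bar y)$. (c) $DF$ is $\kappa$-lower-definite around $(\bar x,\bar y)$ and $F$ is strongly metrically regular at $(\bar x,\bar y)$. Moreover, when $\mathcal{H}$ is finite-dimensional, all these assertions are equivalent to (d) $D_\ast F$ is $\kappa$-lower-definite around $(\bar x,\bar y)$, $\operatorname{gph} F$ is locally closed at $(\bar x,\bar y)$, and $\bar x\in \liminf_{y\to\bar y}F^{-1}(y)$.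
   Context: Hilbert spaces are real, with inner product $\langle\cdot,\cdot\rangle$ and norm $\|\cdot\|$. For $F\colon\mathcal{H}\rightrightarrows\mathcal{H}$, $\operatorname{gph}F=\{(x,y): y\in F(x)\}$ and $F^{-1}(y)=\{x: y\in F(x)\}$. Neighborhoods of pairs are written $U\times V$ with $U,V$ neighborhoods of the components. Local monotonicity: $F$ is locally monotone at $(\bar x,\bar y)\in\operatorname{gph}F$ if there are neighborhoods $U,V$ of $\bar x,\bar y$ such that $\langle y-y',x-x'\rangle\ge 0$ for all $(x,y),(x',y')\in\operatorname{gph}F\cap(U\times V)$. A (globally) monotone operator $S\colon\mathcal H\rightrightarrows\mathcal H$ satisfies $\langle y-y',x-x'\rangle\ge0$ for all $(x,y),(x',y')\in\operatorname{gph}S$. $F$ is locally maximal monotone at $(\bar x,\bar y)$ if $F$ is locally monotone at $(\bar x,\bar y)$ and there is a neighborhood $U\times V$ of $(\bar x,\bar y)$ such that for every globally monotone $S\colon\mathcal{H}\rightrightarrows\mathcal{H}$ with $\operatorname{gph}F\cap (U\times V)\subset\operatorname{gph}S$ one has $\operatorname{gph}F\cap (U\times V)=\operatorname{gph}S\cap (U\times V)$. $F$ is locally maximal hypomonotone at $(\bar x,\bar y)$ if there is $\rho>0$ such that $F+\rho\,\mathrm{Id}$ is locally maximal monotone at $(\bar x,\bar y+\rho\bar x)$. $F$ is strongly locally maximal monotone at $(\bar x,\bar y)$ with modulus $\kappa>0$ if there is a neighborhood $U\times V$ of $(\bar x,\bar y)$ such that $\langle y_1-y_2,x_1-x_2\rangle\ge\kappa\|x_1-x_2\|^2$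 for all $(x_1,y_1),(x_2,y_2)\in(U\times V)\cap\operatorname{gph}F$, and for every monotone operator $S\colon\mathcal{H}\rightrightarrows\mathcal{H}$ with $(U\times V)\cap\operatorname{gph}F\subset\operatorname{gph}S$ one has $(U\times V)\cap\operatorname{gph}F=(U\times V)\cap\operatorname{gph}S$. $F$ is strongly metrically regular at $(\bar x,\bar y)$ if there are a neighborhood $U\times V$ of $(\bar x,\bar y)$ and a Lipschitz function $\vartheta\colon V\to U$ such that $(V\times U)\cap\operatorname{gph}F^{-1}=\operatorname{gph}\vartheta$. Graphical derivative: for $(x,y)\in\operatorname{gph}F$, $v\in DF(x,y)(u)$ iff there are $s_k\searrow0$ ($s_k>0$) and $(u_k,v_k)\to(u,v)$ with $(x,y)+s_k(u_k,v_k)\in\operatorname{gph}F$ for all $k$. Strict graphical derivative: $v\in D_\ast F(x,y)(u)$ iff there are $(x_k,y_k)\in\operatorname{gph}F$ with $(x_k,y_k)\to(x,y)$, $s_k\searrow0$ ($s_k>0$) and $(u_k,v_k)\to(u,v)$ with $(x_k,y_k)+s_k(u_k,v_k)\in\operatorname{gph}F$ for all $k$. For $\rho\in\mathbb{R}$, a set-valued mapping $G\colon\mathcal{H}\rightrightarrows\mathcal{H}$ is $\rho$-lower-definite if $\langle u,v\rangle\ge\rho\|u\|^2$ for all $(u,v)\in\operatorname{gph}G$. $DF$ is $\rho$-lower-definite around $(\bar x,\bar y)$ if there is a neighborhood $A$ of $(\bar x,\bar y)$ such that $DF(x,y)$ is $\rho$-lower-definite for all $(x,y)\in A\cap\operatorname{gph}F$;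 similarly for $D_\ast F$. $\operatorname{gph}F$ is locally closed at $(\bar x,\bar y)$ if its intersection with some closed neighborhood of $(\bar x,\bar y)$ is closed. $\bar x\in\liminf_{y\to\bar y}F^{-1}(y)$ means: for every sequence $y_n\to\bar y$ there are a subsequence $(y_{n_k})$ and points $x_{n_k}\to\bar x$ with $x_{n_k}\in F^{-1}(y_{n_k})$ for all $k$.
   Formalization: In (b), local maximal monotonicity of F+ρId requires monotonicity and maximality on the same neighborhood U×V; with separate neighborhoods, maximality can hold vacuously and (b) would not imply (a). *)

theory Defs
  imports "HOL-Analysis.Analysis"
begin

text \<open>Set-valued mappings are functions into sets; neighborhoods need not be open.\<close>

definition nbhd :: "'a::topological_space set \<Rightarrow> 'a \<Rightarrow> bool" where
  "nbhd U x \<longleftrightarrow> x \<in> interior U"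

definition gph :: "('a \<Rightarrow> 'b set) \<Rightarrow> ('a \<times> 'b) set" where
  "gph F = {(x, y). y \<in> F x}"

definition inv_map :: "('a \<Rightarrow> 'b set) \<Rightarrow> 'b \<Rightarrow> 'a set" where
  "inv_map F y = {x. y \<in> F x}"

definition monotone_graph :: "('a::real_inner \<times> 'a) set \<Rightarrow> bool" where
  "monotone_graph G \<longleftrightarrow>
     (\<forall>(x, y)\<in>G. \<forall>(x', y')\<in>G. inner (y - y') (x - x') \<ge> 0)"

definition monotone_op :: "('a::real_inner \<Rightarrow> 'a set) \<Rightarrow> bool" where
  "monotone_op S \<longleftrightarrow> monotone_graph (gph S)"

definition maximal_in :: "('a::real_inner \<Rightarrow> 'a set) \<Rightarrow> ('a \<times> 'a) set \<Rightarrow> bool" where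
  "maximal_in F W \<longleftrightarrow>
     (\<forall>S. monotone_op S \<and> gph F \<inter> W \<subseteq> gph S \<longrightarrow> gph F \<inter> W = gph S \<inter> W)"

text \<open>Local monotonicity and maximality refer to the same neighborhood \<open>U \<times> V\<close>. Were they
  allowed to use different ones, maximality would hold vacuously as soon as \<open>F\<close> fails to
  be monotone on some large \<open>U \<times> V\<close>, as then no monotone \<open>S\<close> extends its graph there.\<close>

definition locally_maximal_monotone ::
    "('a::real_inner \<Rightarrow> 'a set) \<Rightarrow> 'a \<Rightarrow> 'a \<Rightarrow> bool" where
  "locally_maximal_monotone F x y \<longleftrightarrow>
     (\<exists>U V. nbhd U x \<and> nbhd V y \<and> monotone_graph (gph F \<inter> (U \<times> V)) \<and> maximal_in F (U \<times> V))"

definition plus_scaled_id :: "('a::real_vector \<Rightarrow> 'a set) \<Rightarrow> real \<Rightarrow> 'a \<Rightarrow> 'a set" where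
  "plus_scaled_id F \<rho> x = (\<lambda>y. y + \<rho> *\<^sub>R x) ` F x"

definition locally_maximal_hypomonotone ::
    "('a::real_inner \<Rightarrow> 'a set) \<Rightarrow> 'a \<Rightarrow> 'a \<Rightarrow> bool" where
  "locally_maximal_hypomonotone F x y \<longleftrightarrow>
     (\<exists>\<rho>>0. locally_maximal_monotone (plus_scaled_id F \<rho>) x (y + \<rho> *\<^sub>R x))"

definition strongly_locally_maximal_monotone ::
    "('a::real_inner \<Rightarrow> 'a set) \<Rightarrow> real \<Rightarrow> 'a \<Rightarrow> 'a \<Rightarrow> bool" where
  "strongly_locally_maximal_monotone F \<kappa> x y \<longleftrightarrow>
     (\<exists>U V. nbhd U x \<and> nbhd V y \<and>
        (\<forall>(x1, y1)\<in>gph F \<inter> (U \<times> V). \<forall>(x2, y2)\<in>gph F \<inter> (U \<times> V).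
           inner (y1 - y2) (x1 - x2) \<ge> \<kappa> * (norm (x1 - x2))\<^sup>2) \<and>
        maximal_in F (U \<times> V))"

definition strongly_metrically_regular ::
    "('a::metric_space \<Rightarrow> 'b::metric_space set) \<Rightarrow> 'a \<Rightarrow> 'b \<Rightarrow> bool" where
  "strongly_metrically_regular F x y \<longleftrightarrow>
     (\<exists>U V \<theta> L. nbhd U x \<and> nbhd V y \<and> \<theta> ` V \<subseteq> U \<and> L-lipschitz_on V \<theta> \<and>
        gph (inv_map F) \<inter> (V \<times> U) = {(v, \<theta> v) | v. v \<in> V})"

definition graphical_derivative ::
    "('a::real_normed_vector \<Rightarrow> 'b::real_normed_vector set) \<Rightarrow> 'a \<Rightarrow> 'b \<Rightarrow> 'a \<Rightarrow> 'b set" where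
  "graphical_derivative F x y u =
     {v. \<exists>s us vs. (\<forall>k::nat. s k > 0) \<and> s \<longlonglongrightarrow> 0 \<and> us \<longlonglongrightarrow> u \<and> vs \<longlonglongrightarrow> v \<and>
           (\<forall>k. (x + s k *\<^sub>R us k, y + s k *\<^sub>R vs k) \<in> gph F)}"

definition strict_graphical_derivative ::
    "('a::real_normed_vector \<Rightarrow> 'b::real_normed_vector set) \<Rightarrow> 'a \<Rightarrow> 'b \<Rightarrow> 'a \<Rightarrow> 'b set" where
  "strict_graphical_derivative F x y u =
     {v. \<exists>xs ys s us vs. (\<forall>k::nat. (xs k, ys k) \<in> gph F) \<and> xs \<longlonglongrightarrow> x \<and> ys \<longlonglongrightarrow> y \<and>
           (\<forall>k. s k > 0) \<and> s \<longlonglongrightarrow> 0 \<and> us \<longlonglongrightarrow> u \<and> vs \<longlonglongrightarrow> v \<and>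
           (\<forall>k. (xs k + s k *\<^sub>R us k, ys k + s k *\<^sub>R vs k) \<in> gph F)}"

definition lower_definite :: "real \<Rightarrow> ('a::real_inner \<Rightarrow> 'a set) \<Rightarrow> bool" where
  "lower_definite \<rho> G \<longleftrightarrow> (\<forall>(u, v)\<in>gph G. inner u v \<ge> \<rho> * (norm u)\<^sup>2)"

text \<open>The argument \<open>D\<close> is the derivative of \<open>F\<close>, graphical or strict, as a function of the
  base point.\<close>

definition lower_definite_around ::
    "('a::real_inner \<Rightarrow> 'a \<Rightarrow> 'a \<Rightarrow> 'a set) \<Rightarrow> ('a \<Rightarrow> 'a set) \<Rightarrow> real \<Rightarrow> 'a \<Rightarrow> 'a \<Rightarrow> bool" where
  "lower_definite_around D F \<rho> x y \<longleftrightarrow>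
     (\<exists>A. nbhd A (x, y) \<and> (\<forall>(x', y')\<in>A \<inter> gph F. lower_definite \<rho> (D x' y')))"

definition locally_closed_at :: "'a::topological_space set \<Rightarrow> 'a \<Rightarrow> bool" where
  "locally_closed_at G p \<longleftrightarrow> (\<exists>N. nbhd N p \<and> closed N \<and> closed (G \<inter> N))"

definition set_liminf ::
    "('b::topological_space \<Rightarrow> 'a::topological_space set) \<Rightarrow> 'b \<Rightarrow> 'a set" where
  "set_liminf G y =
     {x. \<forall>ys. ys \<longlonglongrightarrow> y \<longrightarrow>
           (\<exists>r xs. strict_mono (r :: nat \<Rightarrow> nat) \<and> xs \<longlonglongrightarrow> x \<and> (\<forall>k. xs k \<in> G (ys (r k))))}"

end

theory Submission
  imports Defs
begin

text \<open>Lower-definiteness of a derivative of \<open>F\<close> is an infinitesimal condition, strong monotonicity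
  a condition on finite differences. What links them is a local inverse: in each of the assertions
  (b), (c), (d) some \<open>F + \<mu> Id\<close> with \<open>\<mu> \<ge> 0\<close> has a single-valued Lipschitz inverse \<open>X\<close> near the
  reference point (\<open>\<mu> = 0\<close> for (c) and (d), while for (b) Minty's theorem provides it for a
  positive \<open>\<mu>\<close>). Along a segment \<open>W t = w1 + t (w2 - w1)\<close> the curve \<open>X (W t)\<close> is Lipschitz, and
  wherever its difference quotients converge to some \<open>w\<close>, the pair \<open>(w, d - \<mu> w)\<close> with
  \<open>d = w2 - w1\<close> belongs to the graph of \<open>DF\<close>. Thus \<open>(\<kappa> + \<mu>) |w|^2 \<le> <w, d>\<close>, and the same
  inequality for the increment \<open>X w2 - X w1\<close> in place of \<open>w\<close> says that \<open>F\<close> is strongly monotone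
  with modulus \<open>\<kappa>\<close>.

  The passage from derivatives to increments could be an integration, based on the almost
  everywhere differentiability of Lipschitz curves in a Hilbert space. Less is enough: the
  inequality defines a closed ball of admissible \<open>w\<close>, and if the slope of the whole curve lies
  outside this ball, then so does a limit of difference quotients at some point.
  To find this point, compare the energy \<open>\<integral> |f'|^2\<close> of a piece of the curve, understood as a
  supremum over partitions, with the energy of its chord. When the gap is small, the slopes of
  most small pieces are close to the slope of the piece, and after a sufficiently fine partition
  most pieces have an arbitrarily small gap. So intervals can be nested such that
  the gaps decrease geometrically; then the slopes form a Cauchy sequence
  (\<open>difference_quotients_near_slope\<close>, \<open>cocoercive_increment\<close>).

  Strong monotonicity with the Lipschitz inverse of \<open>F + \<mu> Id\<close> gives an inverse of \<open>F\<close> itself, by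
  Banach's fixed point theorem, and an operator whose inverse is locally defined on an open set
  admits no larger monotone graph there (\<open>maximal_in_of_solvable\<close>). This proves (a).

  Conversely, (a) gives local solvability of \<open>w \<in> F x + \<rho> x\<close> for every \<open>\<rho> \<ge> 0\<close>: some monotone
  extension of the localized graph solves the inclusion, the solution stays near the reference
  point by strong monotonicity, and maximality puts it into the graph of \<open>F\<close>
  (\<open>resolvent_locally_solvable\<close>). The lower-definiteness of both derivatives is a passage to the
  limit. In finite dimensions, lower-definiteness of the strict derivative excludes by compactness
  of the unit sphere that \<open>F\<^sup>-\<^sup>1\<close> fails to be Lipschitz near the reference point, and the condition
  on the lower limit makes it nonempty-valued, so that (d) implies (c).\<close>

section \<open>Energy of a Lipschitz curve\<close>

definition slope :: "(real \<Rightarrow> 'a::real_inner) \<Rightarrow> real \<Rightarrow> real \<Rightarrow> 'a" where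
  "slope f a b = (f b - f a) /\<^sub>R (b - a)"

definition chord_energy :: "(real \<Rightarrow> 'a::real_inner) \<Rightarrow> real \<Rightarrow> real \<Rightarrow> real" where
  "chord_energy f a b = (norm (f b - f a))\<^sup>2 / (b - a)"

text \<open>The numbers \<open>v\<close> with \<open>partition_energy f a b v\<close> are the values
  \<open>\<Sum> |f (t (i+1)) - f (t i)|^2 / (t (i+1) - t i)\<close> over the partitions of the interval. Generating
  them by concatenation makes superadditivity of the supremum and sums over the cells of a
  partition matters of rule induction, with no bookkeeping of partition points.\<close>

inductive partition_energy :: "(real \<Rightarrow> 'a::real_inner) \<Rightarrow> real \<Rightarrow> real \<Rightarrow> real \<Rightarrow> bool"
  for f where
  chord: "a < b \<Longrightarrow> partition_energy f a b (chord_energy f a b)"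
| join: "partition_energy f a b v \<Longrightarrow> partition_energy f b c w \<Longrightarrow> partition_energy f a c (v + w)"

definition energy :: "(real \<Rightarrow> 'a::real_inner) \<Rightarrow> real \<Rightarrow> real \<Rightarrow> real" where
  "energy f a b = Sup {v. partition_energy f a b v}"

text \<open>For a continuously differentiable curve this is the mean of \<open>|f' - s|^2\<close> over the interval,
  where \<open>s\<close> is the slope of the chord, that is, the variance of the derivative.\<close>

definition energy_gap :: "(real \<Rightarrow> 'a::real_inner) \<Rightarrow> real \<Rightarrow> real \<Rightarrow> real" where
  "energy_gap f a b = (energy f a b - chord_energy f a b) / (b - a)"

lemma partition_energy_less: "partition_energy f a b v \<Longrightarrow> a < b"
  by (induction rule: partition_energy.induct) auto

lemma scaleR_slope: "a < b \<Longrightarrow> (b - a) *\<^sub>R slope f a b = f b - f a"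
  by (simp add: slope_def)

lemma chord_energy_eq_slope:
  assumes "a < b"
  shows "chord_energy f a b = (b - a) * (norm (slope f a b))\<^sup>2"
proof -
  have "norm (f b - f a) = (b - a) * norm (slope f a b)"
    using scaleR_slope[OF assms, of f, symmetric] assms by simp
  then show ?thesis using assms by (simp add: chord_energy_def power2_eq_square)
qed

text \<open>Expanding the square gives a quantity that is additive over adjacent intervals except for
  the chord energy itself. This is the source of all variance identities below.\<close>

lemma chord_energy_shift:
  assumes "a < b"
  shows "(b - a) * (norm (slope f a b - z))\<^sup>2 =
    chord_energy f a b - 2 * inner (f b - f a) z + (b - a) * (norm z)\<^sup>2"
proof -
  have "(norm (slope f a b - z))\<^sup>2 = (norm (slope f a b))\<^sup>2 - 2 * inner (slope f a b) z + (norm z)\<^sup>2"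
    by (simp add: power2_norm_eq_inner inner_diff inner_commute)
  moreover have "(b - a) * inner (slope f a b) z = inner (f b - f a) z"
    using assms by (simp add: slope_def)
  ultimately show ?thesis
    using chord_energy_eq_slope[OF assms, of f] by (simp only:) (simp add: algebra_simps)
qed

lemma inner_slope: "a < b \<Longrightarrow> inner (f b - f a) (slope f a b) = chord_energy f a b"
  by (simp add: slope_def chord_energy_def power2_norm_eq_inner divide_inverse_commute)

lemma chord_energy_join:
  assumes "a < b" "b < c"
  shows "chord_energy f a b + chord_energy f b c = chord_energy f a c
    + (b - a) * (norm (slope f a b - slope f a c))\<^sup>2 + (c - b) * (norm (slope f b c - slope f a c))\<^sup>2"
proof -
  let ?z = "slope f a c"
  have "inner (f b - f a) ?z + inner (f c - f b) ?z = chord_energy f a c"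
    using inner_slope[of a c f] assms by (simp add: inner_diff_left)
  moreover have "(b - a) * (norm ?z)\<^sup>2 + (c - b) * (norm ?z)\<^sup>2 = chord_energy f a c"
    using chord_energy_eq_slope[of a c f] assms by (simp add: algebra_simps)
  ultimately show ?thesis
    using chord_energy_shift[OF assms(1), of f ?z] chord_energy_shift[OF assms(2), of f ?z] by simp
qed

lemma chord_energy_le_partition_energy:
  "partition_energy f a b v \<Longrightarrow> chord_energy f a b \<le> v"
proof (induction rule: partition_energy.induct)
  case (join a b v c w)
  then have "a < b" "b < c" by (auto dest: partition_energy_less)
  then have "(b - a) * (norm (slope f a b - slope f a c))\<^sup>2 \<ge> 0"
    "(c - b) * (norm (slope f b c - slope f a c))\<^sup>2 \<ge> 0"
    by auto
  then show ?case
    using join.IH chord_energy_join[OF \<open>a < b\<close> \<open>b < c\<close>, of f] by linarith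
qed simp

locale lipschitz_curve =
  fixes f :: "real \<Rightarrow> 'a::real_inner" and L l u :: real
  assumes lip: "L-lipschitz_on {l..u} f"
begin

lemma norm_diff_le: "l \<le> a \<Longrightarrow> a \<le> b \<Longrightarrow> b \<le> u \<Longrightarrow> norm (f b - f a) \<le> L * (b - a)"
  using lipschitz_onD[OF lip, of b a] by (auto simp: dist_norm)

lemma norm_slope_le: "l \<le> a \<Longrightarrow> a < b \<Longrightarrow> b \<le> u \<Longrightarrow> norm (slope f a b) \<le> L"
  using norm_diff_le[of a b] scaleR_slope[of a b f, symmetric] by (simp add: mult.commute)

lemma partition_energy_le:
  "partition_energy f a b v \<Longrightarrow> l \<le> a \<Longrightarrow> b \<le> u \<Longrightarrow> v \<le> L\<^sup>2 * (b - a)"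
proof (induction rule: partition_energy.induct)
  case (chord a b)
  have "(norm (slope f a b))\<^sup>2 \<le> L\<^sup>2"
    using norm_slope_le[of a b] chord by (intro power_mono) auto
  with chord show ?case
    by (simp add: chord_energy_eq_slope mult.commute mult_left_mono)
next
  case (join a b v c w)
  then have "a < b" "b < c" by (auto dest: partition_energy_less)
  with join show ?case by (simp add: algebra_simps)
qed

lemma bdd_above_partition_energy: "l \<le> a \<Longrightarrow> b \<le> u \<Longrightarrow> bdd_above {v. partition_energy f a b v}"
  using partition_energy_le by (auto intro!: bdd_aboveI)

lemma partition_energy_le_energy:
  "partition_energy f a b v \<Longrightarrow> l \<le> a \<Longrightarrow> b \<le> u \<Longrightarrow> v \<le> energy f a b"
  unfolding energy_def by (intro cSup_upper bdd_above_partition_energy) auto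

lemma energy_approx:
  assumes "l \<le> a" "a < b" "b \<le> u" "0 < e"
  obtains v where "partition_energy f a b v" "energy f a b - e < v"
proof -
  have "{v. partition_energy f a b v} \<noteq> {}"
    using partition_energy.chord[OF assms(2)] by auto
  with less_cSupD[of "{v. partition_energy f a b v}" "energy f a b - e"] assms(4) that
  show ?thesis unfolding energy_def by fastforce
qed

lemma energy_superadditive:
  assumes "l \<le> a" "a < b" "b < c" "c \<le> u"
  shows "energy f a b + energy f b c \<le> energy f a c"
proof (rule field_le_epsilon)
  fix e :: real assume "0 < e"
  then have e: "0 < e / 2" by simp
  obtain v where v: "partition_energy f a b v" "energy f a b - e / 2 < v"
    using energy_approx[of a b, OF _ _ _ e] assms by auto
  obtain w where w: "partition_energy f b c w" "energy f b c - e / 2 < w"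
    using energy_approx[of b c, OF _ _ _ e] assms by auto
  have "v + w \<le> energy f a c"
    using partition_energy_le_energy[OF partition_energy.join[OF v(1) w(1)]] assms by simp
  with v(2) w(2) show "energy f a b + energy f b c \<le> energy f a c + e" by (simp add: field_simps)
qed

lemma chord_energy_le_energy: "l \<le> a \<Longrightarrow> a < b \<Longrightarrow> b \<le> u \<Longrightarrow> chord_energy f a b \<le> energy f a b"
  by (simp add: partition_energy_le_energy partition_energy.chord)

lemma energy_gap_nonneg: "l \<le> a \<Longrightarrow> a < b \<Longrightarrow> b \<le> u \<Longrightarrow> 0 \<le> energy_gap f a b"
  by (simp add: energy_gap_def chord_energy_le_energy)

lemma energy_gap_mult: "a < b \<Longrightarrow> (b - a) * energy_gap f a b = energy f a b - chord_energy f a b"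
  by (simp add: energy_gap_def)

text \<open>Splitting an interval distributes its variance: a gap of one part and the deviations of the
  two slopes from the total slope are paid for by the gap of the whole.\<close>

lemma energy_gap_split:
  assumes "l \<le> a" "a < b" "b < c" "c \<le> u"
  shows "(b - a) * energy_gap f a b + (b - a) * (norm (slope f a b - slope f a c))\<^sup>2
    + (c - b) * (norm (slope f b c - slope f a c))\<^sup>2 \<le> (c - a) * energy_gap f a c"
proof -
  have "(c - b) * energy_gap f b c \<ge> 0"
    using energy_gap_nonneg assms by auto
  then show ?thesis
    using energy_superadditive[OF assms] chord_energy_join[OF assms(2,3), of f] assms
    by (auto simp: energy_gap_mult)
qed

text \<open>An arbitrary initial piece has almost the slope of the whole interval, provided that the gap
  is small in comparison with its share of the length. The gap may not control short pieces.\<close>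

lemma slope_left_near:
  assumes "l \<le> a" "a < t" "t \<le> b" "b \<le> u"
  shows "(t - a) * (norm (slope f a t - slope f a b))\<^sup>2 \<le> (b - a) * energy_gap f a b"
proof (cases "t = b")
  case False
  then have "t < b" using assms by simp
  moreover have "(t - a) * energy_gap f a t \<ge> 0"
    using assms energy_gap_nonneg[of a t] by simp
  moreover have "(b - t) * (norm (slope f t b - slope f a b))\<^sup>2 \<ge> 0" using assms by simp
  ultimately show ?thesis using energy_gap_split[of a t b] assms by linarith
qed (use assms energy_gap_nonneg[of a b] in auto)

lemma slope_right_near:
  assumes "l \<le> a" "a \<le> t" "t < b" "b \<le> u"
  shows "(b - t) * (norm (slope f t b - slope f a b))\<^sup>2 \<le> (b - a) * energy_gap f a b"
proof (cases "t = a")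
  case False
  then have "a < t" using assms by simp
  moreover have "(t - a) * energy_gap f a t \<ge> 0"
    using assms energy_gap_nonneg[of a t] \<open>a < t\<close> by simp
  moreover have "(t - a) * (norm (slope f a t - slope f a b))\<^sup>2 \<ge> 0" using assms by simp
  ultimately show ?thesis using energy_gap_split[of a t b] assms by linarith
qed (use assms energy_gap_nonneg[of a b] in auto)

text \<open>An averaging argument: the right-hand side is an upper bound for the mean, weighted by length,
  of the left-hand side over the cells of a partition with energy \<open>v\<close>, because the energies of the
  cells add up to at most the energy of the whole. The three terms allow one to ask at the same
  time for a small gap and for a favourable value of a quadratic function of the slope.\<close>

lemma select_cell:
  assumes "partition_energy f a b v" "l \<le> a" "b \<le> u" "0 \<le> \<alpha>"
  shows "\<exists>x y. a \<le> x \<and> x < y \<and> y \<le> b \<and>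
    \<alpha> * energy_gap f x y + \<beta> * (norm (slope f x y))\<^sup>2 + inner (slope f x y) z \<le>
    (\<alpha> * (energy f a b - v) + \<beta> * v + inner (f b - f a) z) / (b - a)" (is "\<exists>x y. ?P x y")
proof (rule ccontr)
  define c where "c = (\<alpha> * (energy f a b - v) + \<beta> * v + inner (f b - f a) z) / (b - a)"
  define G where "G = (\<lambda>x y. \<alpha> * energy_gap f x y + \<beta> * (norm (slope f x y))\<^sup>2 + inner (slope f x y) z)"
  assume "\<not> (\<exists>x y. ?P x y)"
  then have no: "c < G x y" if "a \<le> x" "x < y" "y \<le> b" for x y
    using that unfolding c_def G_def not_ex by force
  have cell: "(y - x) * G x y = \<alpha> * (energy f x y - chord_energy f x y) + \<beta> * chord_energy f x y
    + inner (f y - f x) z" if "x < y" for x y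
  proof -
    have "(y - x) * inner (slope f x y) z = inner (f y - f x) z"
      using that by (simp add: slope_def)
    moreover have "(y - x) * G x y = \<alpha> * ((y - x) * energy_gap f x y)
        + \<beta> * ((y - x) * (norm (slope f x y))\<^sup>2) + (y - x) * inner (slope f x y) z"
      by (simp add: G_def algebra_simps)
    ultimately show ?thesis
      using that by (simp add: chord_energy_eq_slope energy_gap_mult)
  qed
  have "c * (q - p) < \<alpha> * (energy f p q - w) + \<beta> * w + inner (f q - f p) z"
    if "partition_energy f p q w" "a \<le> p" "q \<le> b" for p q w
    using that
  proof (induction rule: partition_energy.induct)
    case (chord p q)
    have "c * (q - p) < (q - p) * G p q" using no[of p q] chord by (simp add: mult.commute)
    with cell[of p q] chord show ?case by simp
  next
    case (join p q v r w)
    then have "p < q" "q < r" by (auto dest: partition_energy_less)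
    then have "\<alpha> * (energy f p q + energy f q r) \<le> \<alpha> * energy f p r"
      using join.prems assms energy_superadditive[of p q r] by (intro mult_left_mono) auto
    then show ?case using join \<open>p < q\<close> \<open>q < r\<close>
      by (simp add: algebra_simps)
  qed
  from this[OF assms(1)] show False
    using partition_energy_less[OF assms(1)] by (simp add: c_def)
qed

text \<open>The step of the nesting: the new tolerance \<open>e'\<close> is arbitrary, whereas the change of the slope is
  bounded by the old tolerance only. Hence the tolerances can be chosen summable in advance.\<close>

lemma steady_subinterval:
  assumes "l \<le> a" "a < b" "b \<le> u" "energy_gap f a b \<le> e\<^sup>2" "0 < e" "0 < e'"
  shows "\<exists>x y. a \<le> x \<and> x < y \<and> y \<le> b \<and> y - x \<le> (b - a) / 2 \<and>
    energy_gap f x y \<le> e'\<^sup>2 \<and> norm (slope f x y - slope f a b) \<le> 4 * e"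
proof -
  define c where "c = (a + b) / 2"
  have c: "a < c" "c < b" "c - a = (b - a) / 2" using assms(2) by (auto simp: c_def)
  have half: "energy_gap f a c + (norm (slope f a c - slope f a b))\<^sup>2 \<le> 2 * e\<^sup>2"
  proof -
    have "(c - a) * (energy_gap f a c + (norm (slope f a c - slope f a b))\<^sup>2) \<le> (b - a) * energy_gap f a b"
    proof -
      have "0 \<le> (b - c) * (norm (slope f c b - slope f a b))\<^sup>2" using c by simp
      then show ?thesis
        using energy_gap_split[of a c b] assms c(1,2) unfolding distrib_left by linarith
    qed
    also have "\<dots> \<le> (b - a) * e\<^sup>2"
      using assms by (intro mult_left_mono) auto
    also have "\<dots> = (c - a) * (2 * e\<^sup>2)"
      unfolding c(3) by simp
    finally show ?thesis using c by simp
  qed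
  have gap_ac: "energy_gap f a c \<le> 2 * e\<^sup>2"
    using half zero_le_power2[of "norm (slope f a c - slope f a b)"] by linarith
  have "0 \<le> energy_gap f a c" using energy_gap_nonneg[of a c] assms c by simp
  moreover have four: "3 * e\<^sup>2 \<le> (2 * e)\<^sup>2" "2 * e\<^sup>2 \<le> (2 * e)\<^sup>2" by (simp_all add: power_mult_distrib)
  ultimately have "(norm (slope f a c - slope f a b))\<^sup>2 \<le> (2 * e)\<^sup>2"
    using half by linarith
  then have near1: "norm (slope f a c - slope f a b) \<le> 2 * e"
    using assms(5) by (auto intro: power2_le_imp_le)
  \<comment> \<open>A cell of the left half is selected with weight \<open>e\<^sup>2 / \<eta>\<close> on the gap and weight one on the
    squared deviation of the slope. The mean is at most \<open>3 e\<^sup>2\<close>, so the gap is at most \<open>3 \<eta>\<close>.\<close>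
  define \<eta> where "\<eta> = e'\<^sup>2 / 3"
  have \<eta>: "0 < \<eta>" using assms by (simp add: \<eta>_def)
  obtain v where v: "partition_energy f a c v" "energy f a c - \<eta> * (c - a) < v"
    using energy_approx[of a c "\<eta> * (c - a)"] assms c \<eta> by auto
  let ?z = "slope f a c"
  obtain x y where xy: "a \<le> x" "x < y" "y \<le> c"
    and le: "(e\<^sup>2 / \<eta>) * energy_gap f x y + 1 * (norm (slope f x y))\<^sup>2 + inner (slope f x y) (- 2 *\<^sub>R ?z) \<le>
    ((e\<^sup>2 / \<eta>) * (energy f a c - v) + 1 * v + inner (f c - f a) (- 2 *\<^sub>R ?z)) / (c - a)"
    using select_cell[OF v(1), of "e\<^sup>2 / \<eta>" 1 "- 2 *\<^sub>R ?z"] assms c \<eta> by auto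
  have "(e\<^sup>2 / \<eta>) * (energy f a c - v) + 1 * v + inner (f c - f a) (- 2 *\<^sub>R ?z)
    \<le> (3 * e\<^sup>2 - (norm ?z)\<^sup>2) * (c - a)"
  proof -
    have "(e\<^sup>2 / \<eta>) * (energy f a c - v) \<le> (e\<^sup>2 / \<eta>) * (\<eta> * (c - a))"
      using v \<eta> by (intro mult_left_mono) auto
    also have "\<dots> = (c - a) * e\<^sup>2" using \<eta> by simp
    finally have 1: "(e\<^sup>2 / \<eta>) * (energy f a c - v) \<le> (c - a) * e\<^sup>2" .
    have "v \<le> energy f a c"
      using partition_energy_le_energy[OF v(1)] assms c by simp
    also have "\<dots> = chord_energy f a c + (c - a) * energy_gap f a c"
      using c by (simp add: energy_gap_mult)
    also have "\<dots> \<le> chord_energy f a c + (c - a) * (2 * e\<^sup>2)"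
      by (intro add_left_mono mult_left_mono gap_ac) (use c in simp)
    finally have 2: "v \<le> chord_energy f a c + (c - a) * (2 * e\<^sup>2)" .
    have 3: "inner (f c - f a) (- 2 *\<^sub>R ?z) = - 2 * chord_energy f a c"
      using inner_slope[of a c f] c by simp
    have "(3 * e\<^sup>2 - (norm ?z)\<^sup>2) * (c - a) = 3 * ((c - a) * e\<^sup>2) - chord_energy f a c"
      "(c - a) * (2 * e\<^sup>2) = 2 * ((c - a) * e\<^sup>2)"
      using c(1) by (simp_all only: chord_energy_eq_slope) (simp_all add: algebra_simps)
    then show ?thesis using 1 2 unfolding 3 by linarith
  qed
  then have "((e\<^sup>2 / \<eta>) * (energy f a c - v) + 1 * v + inner (f c - f a) (- 2 *\<^sub>R ?z)) / (c - a)
     \<le> 3 * e\<^sup>2 - (norm ?z)\<^sup>2"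
    by (rule iffD2[OF pos_divide_le_eq, rotated]) (use c in simp)
  with le have "(e\<^sup>2 / \<eta>) * energy_gap f x y + (norm (slope f x y - ?z))\<^sup>2 \<le> 3 * e\<^sup>2"
    by (simp add: power2_norm_eq_inner inner_diff inner_commute)
  moreover have gap0: "0 \<le> energy_gap f x y"
    using energy_gap_nonneg[of x y] xy assms c by simp
  ultimately have 1: "(e\<^sup>2 / \<eta>) * energy_gap f x y \<le> 3 * e\<^sup>2"
    and 2: "(norm (slope f x y - ?z))\<^sup>2 \<le> 3 * e\<^sup>2"
  proof -
    assume *: "(e\<^sup>2 / \<eta>) * energy_gap f x y + (norm (slope f x y - ?z))\<^sup>2 \<le> 3 * e\<^sup>2" "0 \<le> energy_gap f x y"
    have "0 \<le> (e\<^sup>2 / \<eta>) * energy_gap f x y" using * \<eta> by simp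
    then show "(e\<^sup>2 / \<eta>) * energy_gap f x y \<le> 3 * e\<^sup>2" "(norm (slope f x y - ?z))\<^sup>2 \<le> 3 * e\<^sup>2"
      using * zero_le_power2[of "norm (slope f x y - ?z)"] by linarith+
  qed
  have "energy_gap f x y \<le> e'\<^sup>2"
  proof -
    have "e\<^sup>2 * (energy_gap f x y / \<eta>) \<le> e\<^sup>2 * 3" using 1 by simp
    then have "energy_gap f x y / \<eta> \<le> 3"
      by (rule mult_left_le_imp_le) (use assms(5) in simp)
    then show ?thesis using \<eta> by (simp add: pos_divide_le_eq \<eta>_def)
  qed
  moreover have "(norm (slope f x y - ?z))\<^sup>2 \<le> (2 * e)\<^sup>2"
    using 2 four by linarith
  then have near2: "norm (slope f x y - ?z) \<le> 2 * e"
    using assms(5) by (auto intro: power2_le_imp_le)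
  have "norm (slope f x y - slope f a b) \<le> 4 * e"
    using norm_triangle_ineq[of "slope f x y - ?z" "?z - slope f a b"] near1 near2 by simp
  ultimately show ?thesis using xy c assms by (intro exI[of _ x] exI[of _ y]) auto
qed

section \<open>Convergent difference quotients\<close>

text \<open>One of the two end points of the interval is at distance at least half the length from \<open>t\<close>,
  and the piece between \<open>t\<close> and that end point is long enough for its slope to be controlled. The
  sign \<open>\<sigma>\<close> records on which side it lies.\<close>

lemma steady_difference_quotient:
  assumes "l \<le> a" "a < b" "b \<le> u" "energy_gap f a b \<le> e\<^sup>2" "0 < e" "a \<le> t" "t \<le> b"
  shows "\<exists>\<sigma>\<in>{1, -1}. \<exists>s. 0 < s \<and> t + \<sigma> * s \<in> {a..b} \<and> s \<le> b - a \<and>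
    norm ((f (t + \<sigma> * s) - f t) /\<^sub>R s - \<sigma> *\<^sub>R slope f a b) \<le> 2 * e"
proof -
  have bound: "norm q \<le> 2 * e"
    if "h * (norm q)\<^sup>2 \<le> (b - a) * energy_gap f a b" "(b - a) / 2 \<le> h" for h and q :: 'a
  proof -
    have "(b - a) / 2 * (norm q)\<^sup>2 \<le> h * (norm q)\<^sup>2"
      using that by (intro mult_right_mono) auto
    also have "\<dots> \<le> (b - a) * energy_gap f a b" by fact
    also have "\<dots> \<le> (b - a) * e\<^sup>2"
      using assms by (intro mult_left_mono) auto
    finally have "(b - a) / 2 * (norm q)\<^sup>2 \<le> (b - a) / 2 * (2 * e\<^sup>2)" by simp
    then have "(norm q)\<^sup>2 \<le> 2 * e\<^sup>2"
      using assms mult_le_cancel_left_pos[of "(b - a) / 2"] by simp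
    moreover have "2 * e\<^sup>2 \<le> (2 * e)\<^sup>2" by (simp add: power_mult_distrib)
    ultimately have "(norm q)\<^sup>2 \<le> (2 * e)\<^sup>2" by linarith
    then show ?thesis using assms(5) by (auto intro: power2_le_imp_le)
  qed
  show ?thesis
  proof (cases "(b - a) / 2 \<le> t - a")
    case True
    then have "a < t" using assms(2) by argo
    moreover have "(f a - f t) /\<^sub>R (t - a) - (-1) *\<^sub>R slope f a b = - (slope f a t - slope f a b)"
      by (simp add: slope_def algebra_simps)
    then have "norm ((f a - f t) /\<^sub>R (t - a) - (-1) *\<^sub>R slope f a b) \<le> 2 * e"
      using bound[OF slope_left_near True] assms \<open>a < t\<close> by (simp only: norm_minus_cancel)
    ultimately show ?thesis using assms
      by (intro bexI[of _ "-1"] exI[of _ "t - a"]) auto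
  next
    case False
    then have "t < b" "(b - a) / 2 \<le> b - t" using assms(2) by argo+
    moreover have "norm ((f b - f t) /\<^sub>R (b - t) - 1 *\<^sub>R slope f a b) \<le> 2 * e"
      using bound[OF slope_right_near[of a t b]] assms \<open>t < b\<close> calculation by (simp add: slope_def)
    ultimately show ?thesis using assms
      by (intro bexI[of _ 1] exI[of _ "b - t"]) auto
  qed
qed

text \<open>With tolerances \<open>e / 2^n\<close> the slopes of the nested intervals are Cauchy, and the difference
  quotients at the common point towards suitable end points have the same limit, up to sign. The
  side may change with \<open>n\<close>, so one passes to a subsequence on which it is constant.\<close>

lemma difference_quotients_near_slope:
  assumes "l \<le> a" "a < b" "b \<le> u" "energy_gap f a b \<le> e\<^sup>2" "0 < e"
    and "complete (UNIV :: 'a set)"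
  shows "\<exists>t w. \<exists>\<sigma>\<in>{1, -1}. \<exists>s. t \<in> {a..b} \<and> norm (w - slope f a b) \<le> 8 * e \<and>
    (\<forall>k::nat. 0 < s k \<and> t + \<sigma> * s k \<in> {a..b}) \<and> s \<longlonglongrightarrow> 0 \<and>
    (\<lambda>k. (f (t + \<sigma> * s k) - f t) /\<^sub>R s k) \<longlonglongrightarrow> \<sigma> *\<^sub>R w"
proof -
  define P where "P = (\<lambda>n::nat. \<lambda>(x, y). a \<le> x \<and> x < y \<and> y \<le> b \<and> energy_gap f x y \<le> (e / 2 ^ n)\<^sup>2
    \<and> (n = 0 \<longrightarrow> (x, y) = (a, b)))"
  define Q where "Q = (\<lambda>n::nat. \<lambda>(x, y) (x', y'). x \<le> x' \<and> y' \<le> y \<and> y' - x' \<le> (y - x) / 2 \<and>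
    norm (slope f x' y' - slope f x y) \<le> 4 * (e / 2 ^ n))"
  have "\<exists>I. \<forall>n. P n (I n) \<and> Q n (I n) (I (Suc n))"
  proof (rule dependent_nat_choice)
    show "\<exists>p. P 0 p" using assms by (intro exI[of _ "(a, b)"]) (auto simp: P_def)
  next
    fix p n assume "P n p"
    moreover obtain x y where "p = (x, y)" by (cases p)
    ultimately have p: "p = (x, y)" "a \<le> x" "x < y" "y \<le> b" "energy_gap f x y \<le> (e / 2 ^ n)\<^sup>2"
      by (auto simp: P_def)
    obtain x' y' where "x \<le> x'" "x' < y'" "y' \<le> y" "y' - x' \<le> (y - x) / 2"
      "energy_gap f x' y' \<le> (e / 2 ^ Suc n)\<^sup>2" "norm (slope f x' y' - slope f x y) \<le> 4 * (e / 2 ^ n)"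
      using steady_subinterval[of x y "e / 2 ^ n" "e / 2 ^ Suc n"] p assms(1,3,5) by auto
    then show "\<exists>p'. P (Suc n) p' \<and> Q n p p'"
      using p by (intro exI[of _ "(x', y')"]) (auto simp: P_def Q_def)
  qed
  then obtain I where I: "\<And>n. P n (I n)" "\<And>n. Q n (I n) (I (Suc n))" by blast
  define x where "x = (\<lambda>n. fst (I n))"
  define y where "y = (\<lambda>n. snd (I n))"
  define m where "m = (\<lambda>n. slope f (x n) (y n))"
  have xy: "a \<le> x n" "x n < y n" "y n \<le> b" "energy_gap f (x n) (y n) \<le> (e / 2 ^ n)\<^sup>2"
    "x n \<le> x (Suc n)" "y (Suc n) \<le> y n" "y (Suc n) - x (Suc n) \<le> (y n - x n) / 2"
    "norm (m (Suc n) - m n) \<le> 4 * (e / 2 ^ n)" for n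
    using I(1)[of n] I(2)[of n] by (auto simp: P_def Q_def x_def y_def m_def split: prod.splits)
  have m0: "m 0 = slope f a b" using I(1)[of 0] by (auto simp: P_def m_def x_def y_def)
  have len: "y n - x n \<le> (b - a) * (1 / 2) ^ n" for n
  proof (induction n)
    case 0
    show ?case using xy(1,3)[of 0] by simp
  next
    case (Suc n)
    then show ?case using xy(7)[of n] by simp
  qed
  have mono: "x i \<le> x (i + k)" "y (i + k) \<le> y i" for i k
    by (induction k) (auto intro: order_trans xy(5,6))
  have geom: "norm (m (i + k) - m i) \<le> 8 * (e / 2 ^ i) - 8 * (e / 2 ^ (i + k))" for i k
  proof (induction k)
    case (Suc k)
    have "norm (m (i + Suc k) - m i) \<le> norm (m (Suc (i + k)) - m (i + k)) + norm (m (i + k) - m i)"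
      using norm_triangle_ineq[of "m (Suc (i + k)) - m (i + k)" "m (i + k) - m i"] by simp
    with Suc xy(8)[of "i + k"] show ?case by simp
  qed simp
  have small: "(\<lambda>n. c / 2 ^ n) \<longlonglongrightarrow> 0" for c :: real
    by (rule LIMSEQ_divide_realpow_zero) simp
  obtain t where t: "\<And>n. x n \<le> t" "\<And>n. t \<le> y n"
  proof
    have le: "x i \<le> y j" for i j
      using mono(1)[of i j] mono(2)[of j i] xy(2)[of "i + j"] by (simp add: add.commute)
    then have "bdd_above (range x)" by (auto intro!: bdd_aboveI)
    then show "x n \<le> (SUP i. x i)" "(SUP i. x i) \<le> y n" for n
      by (auto intro!: cSUP_upper cSUP_least le)
  qed
  have "Cauchy m"
  proof (rule metric_CauchyI)
    fix r :: real assume "0 < r"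
    then obtain N where N: "8 * e / 2 ^ N < r / 2"
      using order_tendstoD(2)[OF small[of "8 * e"], of "r / 2"] by (auto simp: eventually_sequentially)
    have near: "dist (m i) (m N) < r / 2" if "i \<ge> N" for i
    proof -
      have "0 \<le> 8 * (e / 2 ^ i)" using assms(5) by simp
      then show ?thesis using geom[of N "i - N"] that N by (auto simp: dist_norm)
    qed
    show "\<exists>M. \<forall>i\<ge>M. \<forall>j\<ge>M. dist (m i) (m j) < r"
      using near by (metis dist_commute dist_triangle_half_l)
  qed
  then obtain w where w: "m \<longlonglongrightarrow> w"
    using assms(6) unfolding complete_def by auto
  have wnear: "norm (w - slope f a b) \<le> 8 * e"
  proof (rule Lim_bounded)
    show "(\<lambda>n. norm (m n - slope f a b)) \<longlonglongrightarrow> norm (w - slope f a b)"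
      by (intro tendsto_intros w)
    have "0 \<le> 8 * (e / 2 ^ n)" for n using assms(5) by simp
    then have "norm (m n - slope f a b) \<le> 8 * e" for n
      using geom[of 0 n] m0 by (smt (verit) add_0 power_0 div_by_1)
    then show "\<forall>n\<ge>0. norm (m n - slope f a b) \<le> 8 * e" by simp
  qed
  have "\<exists>\<sigma> s. \<forall>n. \<sigma> n \<in> {1, -1} \<and> 0 < s n \<and> t + \<sigma> n * s n \<in> {x n..y n} \<and> s n \<le> y n - x n \<and>
    norm ((f (t + \<sigma> n * s n) - f t) /\<^sub>R s n - \<sigma> n *\<^sub>R m n) \<le> 2 * (e / 2 ^ n)"
  proof -
    have "\<exists>\<sigma> s. \<sigma> \<in> {1, -1} \<and> 0 < s \<and> t + \<sigma> * s \<in> {x n..y n} \<and> s \<le> y n - x n \<and>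
      norm ((f (t + \<sigma> * s) - f t) /\<^sub>R s - \<sigma> *\<^sub>R m n) \<le> 2 * (e / 2 ^ n)" for n
      using steady_difference_quotient[of "x n" "y n" "e / 2 ^ n" t] xy(1-4)[of n] assms t[of n]
      unfolding m_def Bex_def by auto
    then show ?thesis by metis
  qed
  then obtain \<sigma> s where s: "\<And>n. \<sigma> n \<in> {1, -1 :: real}" "\<And>n. 0 < s n" "\<And>n. t + \<sigma> n * s n \<in> {x n..y n}"
    "\<And>n. s n \<le> y n - x n"
    "\<And>n. norm ((f (t + \<sigma> n * s n) - f t) /\<^sub>R s n - \<sigma> n *\<^sub>R m n) \<le> 2 * (e / 2 ^ n)"
    by metis
  obtain \<tau> where \<tau>: "\<tau> \<in> {1, -1}" "infinite {n. \<sigma> n = \<tau>}"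
  proof -
    have "{n. \<sigma> n = 1} \<union> {n. \<sigma> n = -1} = UNIV" using s(1) by auto
    then have "infinite {n. \<sigma> n = 1} \<or> infinite {n. \<sigma> n = -1}"
      by (metis finite_Un infinite_UNIV_nat)
    then show ?thesis using that by auto
  qed
  obtain r :: "nat \<Rightarrow> nat" where r: "strict_mono r" "\<And>k. \<sigma> (r k) = \<tau>"
    using infinite_enumerate[OF \<tau>(2)] by auto
  have "s \<longlonglongrightarrow> 0"
  proof (rule tendsto_sandwich)
    show "(\<lambda>n. 0) \<longlonglongrightarrow> (0::real)" "(\<lambda>n. (b - a) / 2 ^ n) \<longlonglongrightarrow> 0" by (auto intro: small)
    show "\<forall>\<^sub>F n in sequentially. 0 \<le> s n" using s(2) by (simp add: less_imp_le)
    show "\<forall>\<^sub>F n in sequentially. s n \<le> (b - a) / 2 ^ n"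
      using s(4) len by (intro always_eventually allI) (auto intro: order_trans simp: power_divide)
  qed
  then have sr: "(\<lambda>k. s (r k)) \<longlonglongrightarrow> 0"
    using LIMSEQ_subseq_LIMSEQ[OF _ r(1)] by (auto simp: o_def)
  have "(\<lambda>n. (f (t + \<sigma> n * s n) - f t) /\<^sub>R s n - \<sigma> n *\<^sub>R m n) \<longlonglongrightarrow> 0"
  proof (rule Lim_null_comparison)
    show "(\<lambda>n. 2 * e / 2 ^ n) \<longlonglongrightarrow> 0" by (rule small)
  qed (use s(5) in simp)
  then have "(\<lambda>k. (f (t + \<tau> * s (r k)) - f t) /\<^sub>R s (r k) - \<tau> *\<^sub>R m (r k)) \<longlonglongrightarrow> 0"
    using LIMSEQ_subseq_LIMSEQ[OF _ r(1), of "\<lambda>n. (f (t + \<sigma> n * s n) - f t) /\<^sub>R s n - \<sigma> n *\<^sub>R m n" 0] by (simp add: o_def r(2))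
  moreover have "(\<lambda>k. \<tau> *\<^sub>R m (r k)) \<longlonglongrightarrow> \<tau> *\<^sub>R w"
    using LIMSEQ_subseq_LIMSEQ[OF w r(1)] by (auto simp: o_def intro!: tendsto_intros)
  ultimately have "(\<lambda>k. (f (t + \<tau> * s (r k)) - f t) /\<^sub>R s (r k)) \<longlonglongrightarrow> \<tau> *\<^sub>R w"
    using tendsto_add by fastforce
  moreover have "t \<in> {a..b}" using t[of 0] xy(1,3)[of 0] by auto
  moreover have "t + \<tau> * s (r k) \<in> {a..b}" for k
    using s(3)[of "r k"] xy(1)[of "r k"] xy(3)[of "r k"] unfolding r(2) by simp
  ultimately show ?thesis
    using \<tau>(1) s(2) sr wnear
    by (intro exI[of _ t] exI[of _ w] bexI[of _ \<tau>] exI[of _ "\<lambda>k. s (r k)"] conjI allI) auto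
qed

end

text \<open>A mean value inequality. The admissible derivatives \<open>w\<close> form a closed ball; were the increment
  outside, then some subinterval with an arbitrarily small gap would have its slope outside, by a
  definite amount, and so would a limit of difference quotients near that slope.\<close>

lemma cocoercive_increment:
  fixes f :: "real \<Rightarrow> 'a::{real_inner, complete_space}"
  assumes lip: "L-lipschitz_on {0..1} f" and "0 < \<kappa>"
    and deriv: "\<And>t w \<sigma> s. t \<in> {0..1} \<Longrightarrow> \<sigma> \<in> {1, -1} \<Longrightarrow> (\<And>k::nat. 0 < s k) \<Longrightarrow>
      (\<And>k. t + \<sigma> * s k \<in> {0..1}) \<Longrightarrow> s \<longlonglongrightarrow> 0 \<Longrightarrow>
      (\<lambda>k. (f (t + \<sigma> * s k) - f t) /\<^sub>R s k) \<longlonglongrightarrow> \<sigma> *\<^sub>R w \<Longrightarrow> \<kappa> * (norm w)\<^sup>2 \<le> inner w d"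
  shows "\<kappa> * (norm (f 1 - f 0))\<^sup>2 \<le> inner (f 1 - f 0) d"
proof (rule ccontr)
  interpret lipschitz_curve f L 0 1 by unfold_locales (rule lip)
  define q where "q = (\<lambda>z. \<kappa> * (norm z)\<^sup>2 - inner z d)"
  define q0 where "q0 = q (f 1 - f 0)"
  assume "\<not> ?thesis"
  then have q0: "0 < q0" by (simp add: q0_def q_def)
  have L: "0 \<le> L" using lip by (rule lipschitz_on_nonneg)
  define C where "C = \<kappa> * (2 * L + 8) + norm d + 1"
  have C: "0 < C" using L \<open>0 < \<kappa>\<close> by (simp add: C_def add_nonneg_pos)
  \<comment> \<open>\<open>C\<close> bounds the Lipschitz constant of \<open>q\<close> on the ball of radius \<open>L + 8\<close>, so that \<open>q\<close> drops by
    less than \<open>q0 / 2\<close> between the slope of the selected cell and the nearby limit.\<close>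
  define e where "e = min 1 (q0 / (16 * C))"
  have e: "0 < e" "e \<le> 1" "8 * e * C \<le> q0 / 2"
    using q0 C by (auto simp: e_def min_def field_simps)
  define Q where "Q = \<kappa> * L\<^sup>2 + L * norm d"
  have Q: "0 \<le> Q" using L \<open>0 < \<kappa>\<close> by (simp add: Q_def)
  \<comment> \<open>The weight of the gap in the averaging argument: since \<open>q\<close> is at most \<open>Q\<close> on slopes, a cell
    on which \<open>q\<close> dominates \<open>A\<close> times the gap has a gap of at most \<open>e\<^sup>2\<close>.\<close>
  define A where "A = (Q + 1) / e\<^sup>2"
  have A: "0 < A" using Q e by (simp add: A_def)
  obtain v where v: "partition_energy f 0 1 v" "energy f 0 1 - q0 / (2 * A) < v"
    using energy_approx[of 0 1 "q0 / (2 * A)"] q0 A by auto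
  have chord: "(norm (f 1 - f 0))\<^sup>2 \<le> v"
    using chord_energy_le_partition_energy[OF v(1)] by (simp add: chord_energy_def)
  obtain x y where xy: "0 \<le> x" "x < y" "y \<le> 1"
    and le: "A * energy_gap f x y + (- \<kappa>) * (norm (slope f x y))\<^sup>2 + inner (slope f x y) d \<le>
      (A * (energy f 0 1 - v) + (- \<kappa>) * v + inner (f 1 - f 0) d) / (1 - 0)"
    using select_cell[OF v(1), of A "- \<kappa>" d] A by auto
  let ?z = "slope f x y"
  have "A * (energy f 0 1 - v) \<le> q0 / 2"
  proof -
    have "A * (energy f 0 1 - v) \<le> A * (q0 / (2 * A))"
      using v A by (intro mult_left_mono) auto
    then show ?thesis using A by simp
  qed
  moreover have "\<kappa> * (norm (f 1 - f 0))\<^sup>2 \<le> \<kappa> * v"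
    using chord \<open>0 < \<kappa>\<close> by simp
  ultimately have gq: "A * energy_gap f x y + q0 / 2 \<le> q ?z"
  proof -
    assume 1: "A * (energy f 0 1 - v) \<le> q0 / 2" and 2: "\<kappa> * (norm (f 1 - f 0))\<^sup>2 \<le> \<kappa> * v"
    have 3: "q0 = \<kappa> * (norm (f 1 - f 0))\<^sup>2 - inner (f 1 - f 0) d"
      and 4: "q ?z = \<kappa> * (norm ?z)\<^sup>2 - inner ?z d" by (simp_all add: q0_def q_def)
    have "A * energy_gap f x y - \<kappa> * (norm ?z)\<^sup>2 + inner ?z d \<le>
      A * (energy f 0 1 - v) - \<kappa> * v + inner (f 1 - f 0) d" using le by simp
    then show ?thesis using 1 2 3 4 by linarith
  qed
  have gap0: "0 \<le> energy_gap f x y" using xy by (intro energy_gap_nonneg) auto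
  have nz: "norm ?z \<le> L" using xy by (intro norm_slope_le) auto
  have "q ?z \<le> Q"
  proof -
    have "\<kappa> * (norm ?z)\<^sup>2 \<le> \<kappa> * L\<^sup>2"
      using nz \<open>0 < \<kappa>\<close> by (intro mult_left_mono power_mono) auto
    moreover have "- inner ?z d \<le> L * norm d"
      using Cauchy_Schwarz_ineq2[of ?z d] mult_right_mono[OF nz norm_ge_zero[of d]] by linarith
    ultimately show ?thesis by (simp add: q_def Q_def)
  qed
  then have "A * energy_gap f x y \<le> Q + 1" using gq q0 by simp
  then have "(Q + 1) * energy_gap f x y \<le> (Q + 1) * e\<^sup>2"
    using e by (simp add: A_def pos_divide_le_eq)
  then have "energy_gap f x y \<le> e\<^sup>2"
    by (rule mult_left_le_imp_le) (use Q in simp)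
  from difference_quotients_near_slope[OF xy this e(1) complete_UNIV]
  obtain t w \<sigma> s where tw: "t \<in> {x..y}" "norm (w - ?z) \<le> 8 * e" "\<sigma> \<in> {1, -1 :: real}"
    "\<forall>k::nat. 0 < s k \<and> t + \<sigma> * s k \<in> {x..y}" "s \<longlonglongrightarrow> 0"
    "(\<lambda>k. (f (t + \<sigma> * s k) - f t) /\<^sub>R s k) \<longlonglongrightarrow> \<sigma> *\<^sub>R w"
    by blast
  have sub: "r \<in> {0..1}" if "r \<in> {x..y}" for r using that xy by auto
  have "q w \<le> 0"
    using deriv[OF sub[OF tw(1)] tw(3) _ sub tw(5,6)] tw(4) by (simp add: q_def)
  moreover have "q ?z - q w < 8 * e * C"
  proof -
    have nw: "norm w \<le> L + 8"
      using norm_triangle_ineq[of ?z "w - ?z"] nz tw(2) e(2) by simp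
    have dn: "norm ?z - norm w \<le> 8 * e"
      using norm_triangle_ineq[of w "?z - w"] tw(2) by (simp add: norm_minus_commute)
    have "(norm ?z)\<^sup>2 - (norm w)\<^sup>2 = (norm ?z - norm w) * (norm ?z + norm w)"
      by (simp add: power2_eq_square algebra_simps)
    also have "\<dots> \<le> 8 * e * (norm ?z + norm w)"
      using dn by (intro mult_right_mono) auto
    also have "\<dots> \<le> 8 * e * (2 * L + 8)"
      using nw nz e by (intro mult_left_mono) auto
    finally have "\<kappa> * ((norm ?z)\<^sup>2 - (norm w)\<^sup>2) \<le> \<kappa> * (8 * e * (2 * L + 8))"
      using \<open>0 < \<kappa>\<close> by simp
    moreover have "inner (w - ?z) d \<le> 8 * e * norm d"
      using Cauchy_Schwarz_ineq2[of "w - ?z" d] mult_right_mono[OF tw(2) norm_ge_zero[of d]] by linarith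
    ultimately show ?thesis
      using e by (simp add: q_def C_def inner_diff_left algebra_simps)
  qed
  moreover have "0 \<le> A * energy_gap f x y" using A gap0 by simp
  ultimately show False using gq e(3) by linarith
qed

section \<open>Maximal monotone graphs and Minty's theorem\<close>

definition strongly_monotone_graph :: "real \<Rightarrow> ('a::real_inner \<times> 'a) set \<Rightarrow> bool" where
  "strongly_monotone_graph m G \<longleftrightarrow>
     (\<forall>(x, y)\<in>G. \<forall>(x', y')\<in>G. m * (norm (x - x'))\<^sup>2 \<le> inner (y - y') (x - x'))"

lemma strongly_monotone_graphD:
  "strongly_monotone_graph m G \<Longrightarrow> (x, y) \<in> G \<Longrightarrow> (x', y') \<in> G \<Longrightarrow>
    m * (norm (x - x'))\<^sup>2 \<le> inner (y - y') (x - x')"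
  by (auto simp: strongly_monotone_graph_def)

lemma monotone_graphD:
  "monotone_graph G \<Longrightarrow> (x, y) \<in> G \<Longrightarrow> (x', y') \<in> G \<Longrightarrow> 0 \<le> inner (y - y') (x - x')"
  by (auto simp: monotone_graph_def)

lemma monotone_graph_iff_strongly: "monotone_graph G \<longleftrightarrow> strongly_monotone_graph 0 G"
  by (simp add: monotone_graph_def strongly_monotone_graph_def)

definition maximal_monotone_graph :: "('a::real_inner \<times> 'a) set \<Rightarrow> bool" where
  "maximal_monotone_graph M \<longleftrightarrow> monotone_graph M \<and>
     (\<forall>x y. (\<forall>(x', y')\<in>M. 0 \<le> inner (y - y') (x - x')) \<longrightarrow> (x, y) \<in> M)"

lemma maximal_monotone_extension:
  assumes "monotone_graph T"
  shows "\<exists>M. T \<subseteq> M \<and> maximal_monotone_graph M"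
proof -
  define \<A> where "\<A> = {M. T \<subseteq> M \<and> monotone_graph M}"
  have "\<exists>M\<in>\<A>. \<forall>X\<in>\<A>. M \<subseteq> X \<longrightarrow> X = M"
  proof (rule subset_Zorn_nonempty)
    show "\<A> \<noteq> {}" using assms by (auto simp: \<A>_def)
    fix \<C> assume "\<C> \<noteq> {}" and ch: "subset.chain \<A> \<C>"
    then have sub: "\<C> \<subseteq> \<A>" by (simp add: subset.chain_def)
    have "T \<subseteq> \<Union>\<C>" using \<open>\<C> \<noteq> {}\<close> sub by (auto simp: \<A>_def)
    moreover have "monotone_graph (\<Union>\<C>)"
      unfolding monotone_graph_def
    proof clarify
      fix x y X x' y' X' assume X: "(x, y) \<in> X" "X \<in> \<C>" "(x', y') \<in> X'" "X' \<in> \<C>"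
      then have "X \<subseteq> X' \<or> X' \<subseteq> X" using ch by (auto simp: subset.chain_def)
      then obtain Z where "Z \<in> \<C>" "(x, y) \<in> Z" "(x', y') \<in> Z" using X by auto
      then show "0 \<le> inner (y - y') (x - x')"
        using sub monotone_graphD[of Z] by (auto simp: \<A>_def)
    qed
    ultimately show "\<Union>\<C> \<in> \<A>" by (simp add: \<A>_def)
  qed
  then obtain M where M: "T \<subseteq> M" "monotone_graph M"
    and max: "\<And>X. T \<subseteq> X \<Longrightarrow> monotone_graph X \<Longrightarrow> M \<subseteq> X \<Longrightarrow> X = M"
    by (auto simp: \<A>_def)
  have "(x, y) \<in> M" if rel: "\<forall>(x', y')\<in>M. 0 \<le> inner (y - y') (x - x')" for x y
  proof -
    have swap: "inner (y' - y) (x' - x) = inner (y - y') (x - x')" for x' y'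
      by (simp add: inner_diff algebra_simps)
    have "monotone_graph (insert (x, y) M)"
      unfolding monotone_graph_def using M(2) rel by (auto simp: swap monotone_graph_def)
    then have "insert (x, y) M = M" using M(1) by (intro max) auto
    then show "(x, y) \<in> M" by auto
  qed
  then show ?thesis using M unfolding maximal_monotone_graph_def by blast
qed

text \<open>\<open>bd p r\<close> says that \<open>r\<close> bounds the function \<open>|p|^2 / 2 + sup (inner p a - c)\<close> at \<open>p\<close>; working with
  bounds avoids suprema that may be infinite. A minimizing sequence is Cauchy by the parallelogram
  law, and comparing the minimizer with points on a segment gives quadratic growth.\<close>

lemma strongly_convex_sup_minimizer:
  fixes I :: "('b::{real_inner, complete_space} \<times> real) set"
  defines "bd \<equiv> \<lambda>p r. \<forall>(a, c)\<in>I. inner p a - c + (norm p)\<^sup>2 / 2 \<le> r"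
  assumes ex: "bd p1 r1" and below: "\<And>p r. bd p r \<Longrightarrow> B \<le> r"
  shows "\<exists>p0 r0. bd p0 r0 \<and> (\<forall>p r. bd p r \<longrightarrow> r0 + (norm (p - p0))\<^sup>2 / 2 \<le> r)"
proof -
  define r0 where "r0 = Inf {r. \<exists>p. bd p r}"
  have bb: "bdd_below {r. \<exists>p. bd p r}" using below by (auto intro!: bdd_belowI)
  have inf: "r0 \<le> r" if "bd p r" for p r
    unfolding r0_def using that by (intro cInf_lower bb) auto
  have convex: "bd ((1 - t) *\<^sub>R p + t *\<^sub>R q) ((1 - t) * r + t * s - t * (1 - t) * (norm (p - q))\<^sup>2 / 2)"
    if "bd p r" "bd q s" "0 \<le> t" "t \<le> 1" for p q r s t
    unfolding bd_def
  proof clarify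
    fix a c assume "(a, c) \<in> I"
    then have "(1 - t) * (inner p a - c + (norm p)\<^sup>2 / 2) \<le> (1 - t) * r"
      "t * (inner q a - c + (norm q)\<^sup>2 / 2) \<le> t * s"
      using that by (auto simp: bd_def intro!: mult_left_mono)
    moreover have "(norm ((1 - t) *\<^sub>R p + t *\<^sub>R q))\<^sup>2
        = (1 - t) * (norm p)\<^sup>2 + t * (norm q)\<^sup>2 - t * (1 - t) * (norm (p - q))\<^sup>2"
      by (simp add: power2_norm_eq_inner inner_add inner_diff inner_commute[of q p] algebra_simps)
    ultimately show "inner ((1 - t) *\<^sub>R p + t *\<^sub>R q) a - c + (norm ((1 - t) *\<^sub>R p + t *\<^sub>R q))\<^sup>2 / 2
        \<le> (1 - t) * r + t * s - t * (1 - t) * (norm (p - q))\<^sup>2 / 2"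
      by (simp add: inner_add_left algebra_simps add_divide_distrib diff_divide_distrib)
  qed
  have "\<exists>p. bd p (r0 + 1 / Suc n)" for n
  proof -
    have "Inf {r. \<exists>p. bd p r} < r0 + 1 / Suc n" by (simp add: r0_def)
    from cInf_lessD[OF _ this] obtain p r where "bd p r" "r < r0 + 1 / Suc n"
      using ex by auto
    then have "bd p (r0 + 1 / Suc n)" unfolding bd_def by (auto intro: order_trans less_imp_le)
    then show ?thesis by auto
  qed
  then obtain P where P: "\<And>n. bd (P n) (r0 + 1 / Suc n)" by metis
  have dist2: "(norm (P i - P j))\<^sup>2 \<le> 8 / Suc n" if "n \<le> i" "n \<le> j" for i j n
  proof -
    have "r0 \<le> (1 - 1/2) * (r0 + 1 / Suc i) + 1/2 * (r0 + 1 / Suc j)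
        - 1/2 * (1 - 1/2) * (norm (P i - P j))\<^sup>2 / 2"
      by (rule inf[OF convex[OF P P]]) auto
    moreover have "1 / real (Suc i) \<le> 1 / Suc n" "1 / real (Suc j) \<le> 1 / Suc n"
      using that by (auto intro!: divide_left_mono)
    moreover have "N \<le> 8 * \<gamma>" if "r0 \<le> (1 - 1/2) * (r0 + \<alpha>) + 1/2 * (r0 + \<beta>) - 1/2 * (1 - 1/2) * N / 2"
      "\<alpha> \<le> \<gamma>" "\<beta> \<le> \<gamma>" for N \<alpha> \<beta> \<gamma> :: real
      using that by (simp add: field_simps)
    ultimately have "(norm (P i - P j))\<^sup>2 \<le> 8 * (1 / real (Suc n))" by blast
    then show ?thesis by simp
  qed
  have "Cauchy P"
  proof (rule metric_CauchyI)
    fix e :: real assume "0 < e"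
    then obtain n where n: "8 / e\<^sup>2 < real n" using reals_Archimedean2 by blast
    then have "8 / Suc n < e\<^sup>2"
      using \<open>0 < e\<close> by (simp add: field_simps) (smt (verit) zero_less_power)
    then have "norm (P i - P j) < e" if "n \<le> i" "n \<le> j" for i j
      using dist2[OF that] \<open>0 < e\<close> by (smt (verit) power2_le_imp_le norm_ge_zero power_mono)
    then show "\<exists>M. \<forall>i\<ge>M. \<forall>j\<ge>M. dist (P i) (P j) < e" by (auto simp: dist_norm)
  qed
  then obtain p0 where p0: "P \<longlonglongrightarrow> p0" using Cauchy_convergent convergent_def by blast
  have bd0: "bd p0 r0"
    unfolding bd_def
  proof clarify
    fix a c assume "(a, c) \<in> I"
    then have le: "inner (P n) a - c + (norm (P n))\<^sup>2 / 2 \<le> r0 + 1 / Suc n" for n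
      using P[of n] by (auto simp: bd_def)
    have l1: "(\<lambda>n. inner (P n) a - c + (norm (P n))\<^sup>2 / 2) \<longlonglongrightarrow> inner p0 a - c + (norm p0)\<^sup>2 / 2"
      by (intro tendsto_intros p0) auto
    have l2: "(\<lambda>n. r0 + 1 / Suc n) \<longlonglongrightarrow> r0 + 0"
      by (intro tendsto_add tendsto_const LIMSEQ_Suc[OF lim_1_over_n])
    show "inner p0 a - c + (norm p0)\<^sup>2 / 2 \<le> r0"
      using LIMSEQ_le[OF l1 l2] le by auto
  qed
  show ?thesis
  proof (intro exI conjI allI impI)
    show "bd p0 r0" by (rule bd0)
    fix p r assume bd: "bd p r"
    define D where "D = (norm (p - p0))\<^sup>2 / 2"
    show "r0 + (norm (p - p0))\<^sup>2 / 2 \<le> r"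
    proof (rule ccontr)
      assume "\<not> ?thesis"
      then have lt: "r - r0 < D" by (simp add: D_def)
      have r: "r0 \<le> r" by (rule inf[OF bd])
      then have D: "0 < D" using lt by simp
      define t where "t = (1 - (r - r0) / D) / 2"
      have half: "(1 - t) * D = (D + (r - r0)) / 2" using D by (simp add: t_def field_simps)
      have t: "0 < t" "t \<le> 1" using lt D r by (auto simp: t_def field_simps)
      have less: "r - r0 < (1 - t) * D" unfolding half using lt by argo
      have "r0 \<le> (1 - t) * r0 + t * r - t * (1 - t) * (norm (p0 - p))\<^sup>2 / 2"
        using t by (intro inf[OF convex[OF bd0 bd]]) auto
      then have "t * ((1 - t) * D) \<le> t * (r - r0)"
        by (simp add: D_def norm_minus_commute algebra_simps)
      then show False using t less by simp
    qed
  qed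
qed

text \<open>The proof minimizes \<open>\<phi>(x, y) + (|x|^2 + |y|^2) / 2\<close>, where \<open>\<phi>\<close> is the Fitzpatrick function
  \<open>\<phi>(x, y) = sup (inner x y' + inner y x' - inner x' y')\<close> over \<open>(x', y') \<in> M\<close>. Maximality gives
  \<open>\<phi>(x, y) \<ge> inner x y\<close>, with equality on \<open>M\<close>. For the minimizer \<open>(x0, y0)\<close>, quadratic growth at
  the points of \<open>M\<close> says that \<open>(- y0, - x0)\<close> is monotonically related to \<open>M\<close> with the surplus
  \<open>|x0 + y0|^2\<close>. By maximality it belongs to \<open>M\<close>, and being related to itself it has no surplus.\<close>

theorem minty_surjectivity:
  fixes M :: "('a::{real_inner, complete_space} \<times> 'a) set"
  assumes "maximal_monotone_graph M"
  shows "\<exists>x. (x, - x) \<in> M"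
proof -
  have mono: "monotone_graph M"
    and maximal: "\<And>x y. (\<And>x' y'. (x', y') \<in> M \<Longrightarrow> 0 \<le> inner (y - y') (x - x')) \<Longrightarrow> (x, y) \<in> M"
    using assms unfolding maximal_monotone_graph_def by blast+
  \<comment> \<open>The components are swapped because \<open>\<phi>\<close> pairs \<open>x\<close> with \<open>y'\<close> and \<open>y\<close> with \<open>x'\<close>.\<close>
  define I where "I = (\<lambda>(x, y). ((y, x), inner x y)) ` M"
  define bd where "bd = (\<lambda>p r. \<forall>(a, c)\<in>I. inner p a - c + (norm p)\<^sup>2 / 2 \<le> r)"
  have bd: "bd (x, y) r \<longleftrightarrow> (\<forall>(x', y')\<in>M. inner x y' + inner y x' - inner x' y'
      + ((norm x)\<^sup>2 + (norm y)\<^sup>2) / 2 \<le> r)" for x y r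
    by (auto simp: bd_def I_def norm_Pair)
  have lower: "inner x y + ((norm x)\<^sup>2 + (norm y)\<^sup>2) / 2 \<le> r" if b: "bd (x, y) r" for x y r
  proof (cases "(x, y) \<in> M")
    case True
    then show ?thesis using b by (auto simp: bd inner_commute)
  next
    case False
    then obtain x' y' where "(x', y') \<in> M" "inner (y - y') (x - x') < 0"
      using maximal[of y x] by fastforce
    moreover from this have "inner x y' + inner y x' - inner x' y'
      + ((norm x)\<^sup>2 + (norm y)\<^sup>2) / 2 \<le> r" using b bd by auto
    ultimately show ?thesis by (simp add: inner_diff inner_commute)
  qed
  have on_graph: "bd (x, y) (inner x y + ((norm x)\<^sup>2 + (norm y)\<^sup>2) / 2)" if "(x, y) \<in> M" for x y
    unfolding bd
  proof clarify
    fix x' y' assume "(x', y') \<in> M"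
    from monotone_graphD[OF mono that this]
    show "inner x y' + inner y x' - inner x' y' + ((norm x)\<^sup>2 + (norm y)\<^sup>2) / 2
      \<le> inner x y + ((norm x)\<^sup>2 + (norm y)\<^sup>2) / 2"
      by (simp add: inner_diff inner_commute)
  qed
  have "M \<noteq> {}" using maximal by auto
  then obtain x1 y1 where "(x1, y1) \<in> M" by auto
  from on_graph[OF this] have ex: "bd (x1, y1) (inner x1 y1 + ((norm x1)\<^sup>2 + (norm y1)\<^sup>2) / 2)" .
  have nonneg: "0 \<le> r" if "bd p r" for p r
  proof -
    obtain x y where "p = (x, y)" by (cases p)
    moreover have "(norm (x + y))\<^sup>2 = (norm x)\<^sup>2 + 2 * inner x y + (norm y)\<^sup>2"
      by (simp add: power2_norm_eq_inner inner_add inner_commute)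
    then have "0 \<le> inner x y + ((norm x)\<^sup>2 + (norm y)\<^sup>2) / 2"
      using zero_le_power2[of "norm (x + y)"] by argo
    ultimately show ?thesis using lower[of x y r] that by auto
  qed
  obtain p0 r0 where p0: "bd p0 r0" "\<And>p r. bd p r \<Longrightarrow> r0 + (norm (p - p0))\<^sup>2 / 2 \<le> r"
    using strongly_convex_sup_minimizer[OF ex[unfolded bd_def], of 0] nonneg
    unfolding bd_def by blast
  obtain x0 y0 where xy0: "p0 = (x0, y0)" by (cases p0)
  have r0: "inner x0 y0 + ((norm x0)\<^sup>2 + (norm y0)\<^sup>2) / 2 \<le> r0"
    using lower p0(1) xy0 by auto
  have key: "(norm (x0 + y0))\<^sup>2 \<le> inner (x' + y0) (y' + x0)" if "(x', y') \<in> M" for x' y'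
  proof -
    have "r0 + ((norm (x' - x0))\<^sup>2 + (norm (y' - y0))\<^sup>2) / 2 \<le> inner x' y' + ((norm x')\<^sup>2 + (norm y')\<^sup>2) / 2"
      using p0(2)[OF on_graph[OF that]] by (simp add: xy0 norm_Pair)
    with r0 show ?thesis
      by (simp add: power2_norm_eq_inner inner_add inner_diff inner_commute field_simps)
  qed
  have "(- y0, - x0) \<in> M"
  proof (rule maximal)
    fix x' y' assume "(x', y') \<in> M"
    from key[OF this] have "0 \<le> inner (x' + y0) (y' + x0)" by (smt (verit) zero_le_power2)
    then show "0 \<le> inner (- x0 - y') (- y0 - x')"
      by (simp add: inner_add inner_diff inner_commute)
  qed
  moreover from key[OF this] have "x0 + y0 = 0" by simp
  then have "y0 = - x0" by (simp add: add_eq_0_iff)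
  ultimately show ?thesis by auto
qed

text \<open>Subtracting \<open>m x\<close> leaves a monotone graph, and after an affine change of the second component the
  inclusion to be solved becomes \<open>- x \<in> M x\<close> for a maximal monotone extension \<open>M\<close>.\<close>

lemma strongly_monotone_extension_solving:
  fixes T :: "('a::{real_inner, complete_space} \<times> 'a) set"
  assumes T: "strongly_monotone_graph m T" and pos: "0 < m + \<rho>"
  obtains S x y where "T \<subseteq> S" "strongly_monotone_graph m S" "(x, y) \<in> S" "y + \<rho> *\<^sub>R x = z"
proof -
  define \<phi> where "\<phi> = (\<lambda>(x::'a, y). (x, (y - m *\<^sub>R x - z) /\<^sub>R (m + \<rho>)))"
  have inner_\<phi>: "inner ((y - m *\<^sub>R x - z) /\<^sub>R (m + \<rho>) - (y' - m *\<^sub>R x' - z) /\<^sub>R (m + \<rho>)) (x - x')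
      = (inner (y - y') (x - x') - m * (norm (x - x'))\<^sup>2) / (m + \<rho>)" for x y x' y'
  proof -
    have "(y - m *\<^sub>R x - z) /\<^sub>R (m + \<rho>) - (y' - m *\<^sub>R x' - z) /\<^sub>R (m + \<rho>)
      = ((y - y') - m *\<^sub>R (x - x')) /\<^sub>R (m + \<rho>)"
      by (simp add: algebra_simps)
    then show ?thesis
      by (simp add: power2_norm_eq_inner inner_diff_left divide_inverse_commute)
  qed
  have "0 \<le> inner (snd (\<phi> p) - snd (\<phi> p')) (fst (\<phi> p) - fst (\<phi> p'))" if "p \<in> T" "p' \<in> T" for p p'
  proof -
    obtain x y x' y' where p: "p = (x, y)" "p' = (x', y')" by (cases p, cases p')
    then have "m * (norm (x - x'))\<^sup>2 \<le> inner (y - y') (x - x')"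
      using strongly_monotone_graphD[OF T] that by simp
    then show ?thesis
      unfolding p \<phi>_def using pos by (simp only: prod.case fst_conv snd_conv inner_\<phi>) simp
  qed
  then have "monotone_graph (\<phi> ` T)"
    unfolding monotone_graph_def by (auto simp: split_beta)
  then obtain M where M: "\<phi> ` T \<subseteq> M" "maximal_monotone_graph M"
    using maximal_monotone_extension by blast
  obtain x where x: "(x, - x) \<in> M" using minty_surjectivity[OF M(2)] by blast
  show thesis
  proof (rule that[of "\<phi> -` M" x "z - \<rho> *\<^sub>R x"])
    show "T \<subseteq> \<phi> -` M" using M(1) by auto
    have "m * (norm (x - x'))\<^sup>2 \<le> inner (y - y') (x - x')"
      if "(x, y) \<in> \<phi> -` M" "(x', y') \<in> \<phi> -` M" for x y x' y'
    proof -
      have "0 \<le> (inner (y - y') (x - x') - m * (norm (x - x'))\<^sup>2) / (m + \<rho>)"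
        unfolding inner_\<phi>[symmetric] using that M(2)
        by (auto simp: \<phi>_def maximal_monotone_graph_def dest: monotone_graphD)
      then show ?thesis using pos by (simp add: zero_le_divide_iff)
    qed
    then show "strongly_monotone_graph m (\<phi> -` M)"
      unfolding strongly_monotone_graph_def by blast
    have "(- ((m + \<rho>) *\<^sub>R x)) /\<^sub>R (m + \<rho>) = - x" using pos by simp
    then show "(x, z - \<rho> *\<^sub>R x) \<in> \<phi> -` M"
      using x by (simp add: \<phi>_def algebra_simps)
  qed simp
qed

section \<open>Local solvability and local maximality\<close>

lemma nbhd_iff_ball: "nbhd U (x::'a::metric_space) \<longleftrightarrow> (\<exists>e>0. ball x e \<subseteq> U)"
  unfolding nbhd_def mem_interior ..

lemma nbhd_Pair_iff_ball:
  fixes x :: "'a::metric_space" and y :: "'b::metric_space"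
  shows "nbhd N (x, y) \<longleftrightarrow> (\<exists>e>0. ball x e \<times> ball y e \<subseteq> N)"
proof
  assume "nbhd N (x, y)"
  then obtain e where e: "0 < e" "ball (x, y) e \<subseteq> N" by (auto simp: nbhd_iff_ball)
  have "ball x (e / 2) \<times> ball y (e / 2) \<subseteq> ball (x, y) e"
  proof clarify
    fix x' y' assume "x' \<in> ball x (e / 2)" "y' \<in> ball y (e / 2)"
    then have "sqrt ((dist x x')\<^sup>2 + (dist y y')\<^sup>2) < e"
      using sqrt_sum_squares_le_sum[of "dist x x'" "dist y y'"] by simp
    then show "(x', y') \<in> ball (x, y) e" by (simp add: dist_Pair_Pair)
  qed
  with e show "\<exists>e>0. ball x e \<times> ball y e \<subseteq> N" by (intro exI[of _ "e / 2"]) auto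
next
  assume "\<exists>e>0. ball x e \<times> ball y e \<subseteq> N"
  then obtain e where "0 < e" "ball x e \<times> ball y e \<subseteq> N" by auto
  then show "nbhd N (x, y)"
    unfolding nbhd_def
    by (intro interiorI[of "ball x e \<times> ball y e"] open_Times) auto
qed

lemma mem_gph [simp]: "(x, y) \<in> gph F \<longleftrightarrow> y \<in> F x"
  by (simp add: gph_def)

lemma mem_plus_scaled_id: "w \<in> plus_scaled_id F \<rho> x \<longleftrightarrow> w - \<rho> *\<^sub>R x \<in> F x"
  unfolding plus_scaled_id_def by (auto intro: image_eqI[of _ _ "w - \<rho> *\<^sub>R x"])

text \<open>Strong monotonicity makes the inverse Lipschitz.\<close>

lemma norm_le_of_strong_monotone:
  fixes a b :: "'a::real_inner"
  assumes "c * (norm a)\<^sup>2 \<le> inner b a"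
  shows "c * norm a \<le> norm b"
proof (cases "a = 0")
  case False
  have "c * norm a * norm a \<le> norm b * norm a"
    using assms norm_cauchy_schwarz[of b a] by (simp add: power2_eq_square mult.assoc)
  then show ?thesis using False by simp
qed simp

lemma strongly_locally_maximal_monotone_iff:
  "strongly_locally_maximal_monotone F \<kappa> x y \<longleftrightarrow>
    (\<exists>U V. nbhd U x \<and> nbhd V y \<and> strongly_monotone_graph \<kappa> (gph F \<inter> (U \<times> V)) \<and> maximal_in F (U \<times> V))"
  by (simp add: strongly_locally_maximal_monotone_def strongly_monotone_graph_def)

text \<open>Some strongly monotone extension \<open>S\<close> of the localized graph contains a solution \<open>(x', y')\<close>. Since
  \<open>S\<close> also contains \<open>(x, y)\<close>, the solution is close to it whenever \<open>w\<close> is close to \<open>y + \<rho> x\<close>. It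
  therefore lies in \<open>U \<times> V\<close>, where maximality identifies \<open>S\<close> with \<open>F\<close>.\<close>

lemma resolvent_locally_solvable:
  fixes F :: "'a::{real_inner, complete_space} \<Rightarrow> 'a set"
  assumes xy: "y \<in> F x" and U: "nbhd U x" and V: "nbhd V y"
    and T: "strongly_monotone_graph m (gph F \<inter> (U \<times> V))" and max: "maximal_in F (U \<times> V)"
    and m: "0 \<le> m" and pos: "0 < m + \<rho>" and e: "0 < e"
  obtains r where "0 < r"
    "\<And>w. w \<in> ball (y + \<rho> *\<^sub>R x) r \<Longrightarrow> \<exists>x'\<in>ball x e. \<exists>y'\<in>ball y e. y' \<in> F x' \<and> y' + \<rho> *\<^sub>R x' = w"
proof -
  obtain a where a: "0 < a" "ball x a \<subseteq> U" "ball y a \<subseteq> V"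
  proof -
    obtain a1 a2 where "0 < a1" "ball x a1 \<subseteq> U" "0 < a2" "ball y a2 \<subseteq> V"
      using U V unfolding nbhd_iff_ball by blast
    then show ?thesis by (intro that[of "min a1 a2"]) auto
  qed
  define K where "K = 1 + (1 + \<bar>\<rho>\<bar>) / (m + \<rho>)"
  have K: "0 < K" using pos by (simp add: K_def add_pos_nonneg)
  define r where "r = min a e / K"
  show thesis
  proof (rule that[of r])
    show "0 < r" using a e K by (simp add: r_def)
    fix w assume w: "w \<in> ball (y + \<rho> *\<^sub>R x) r"
    obtain S x' y' where S: "gph F \<inter> (U \<times> V) \<subseteq> S" "strongly_monotone_graph m S"
      "(x', y') \<in> S" "y' + \<rho> *\<^sub>R x' = w"
      using strongly_monotone_extension_solving[OF T pos] by blast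
    have "x \<in> U" "y \<in> V" using a by auto
    then have "(x, y) \<in> S" using S(1) xy by auto
    from strongly_monotone_graphD[OF S(2,3) this]
    have "(m + \<rho>) * (norm (x' - x))\<^sup>2 \<le> inner (w - (y + \<rho> *\<^sub>R x)) (x' - x)"
      by (simp add: S(4)[symmetric] power2_norm_eq_inner inner_diff inner_add algebra_simps)
    from norm_le_of_strong_monotone[OF this]
    have dx: "norm (x' - x) \<le> norm (w - (y + \<rho> *\<^sub>R x)) / (m + \<rho>)"
      using pos by (simp add: pos_le_divide_eq mult.commute)
    have y': "y' - y = (w - (y + \<rho> *\<^sub>R x)) - \<rho> *\<^sub>R (x' - x)"
      by (simp add: S(4)[symmetric] algebra_simps)
    have dy: "norm (y' - y) \<le> norm (w - (y + \<rho> *\<^sub>R x)) + \<bar>\<rho>\<bar> * norm (x' - x)"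
      unfolding y' by (rule order_trans[OF norm_triangle_ineq4]) simp
    let ?n = "norm (w - (y + \<rho> *\<^sub>R x))"
    have "K * ?n < min a e"
      using w K by (simp add: r_def dist_norm norm_minus_commute pos_less_divide_eq mult.commute)
    moreover have "?n / (m + \<rho>) \<le> K * ?n"
    proof -
      have "1 / (m + \<rho>) \<le> K" using pos by (simp add: K_def add_divide_distrib)
      from mult_right_mono[OF this norm_ge_zero[of "w - (y + \<rho> *\<^sub>R x)"]] show ?thesis by simp
    qed
    moreover have "?n + \<bar>\<rho>\<bar> * (?n / (m + \<rho>)) \<le> K * ?n"
    proof -
      have "1 + \<bar>\<rho>\<bar> / (m + \<rho>) \<le> K" using pos by (simp add: K_def add_divide_distrib)
      from mult_right_mono[OF this norm_ge_zero[of "w - (y + \<rho> *\<^sub>R x)"]] show ?thesis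
        by (simp add: distrib_right)
    qed
    moreover have "\<bar>\<rho>\<bar> * norm (x' - x) \<le> \<bar>\<rho>\<bar> * (?n / (m + \<rho>))"
      using dx by (intro mult_left_mono) auto
    ultimately have near: "norm (x' - x) < min a e" "norm (y' - y) < min a e"
      using dx dy by linarith+
    then have "x' \<in> U" "y' \<in> V" using a by (auto simp: subset_iff dist_norm norm_minus_commute)
    define S' where "S' = (\<lambda>x. {y. (x, y) \<in> S})"
    have gS: "gph S' = S" by (auto simp: gph_def S'_def)
    have "monotone_op S'"
      unfolding monotone_op_def gS monotone_graph_def
    proof clarify
      fix a b c d assume "(a, b) \<in> S" "(c, d) \<in> S"
      from strongly_monotone_graphD[OF S(2) this] m
      show "0 \<le> inner (b - d) (a - c)" by (smt (verit) mult_nonneg_nonneg zero_le_power2)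
    qed
    then have "gph F \<inter> (U \<times> V) = S \<inter> (U \<times> V)"
      using max S(1) unfolding maximal_in_def by (metis gS)
    then have "(x', y') \<in> gph F \<inter> (U \<times> V)" using S(3) \<open>x' \<in> U\<close> \<open>y' \<in> V\<close> by simp
    then have "y' \<in> F x'" by simp
    then show "\<exists>x'\<in>ball x e. \<exists>y'\<in>ball y e. y' \<in> F x' \<and> y' + \<rho> *\<^sub>R x' = w"
      using near S(4)
      by (intro bexI[of _ x'] bexI[of _ y'] conjI) (auto simp: dist_norm norm_minus_commute)
  qed
qed

text \<open>Minty's trick in a local form. Let a monotone extension contain \<open>(x, y)\<close>, and let \<open>z\<close> be the
  solution of \<open>y \<in> F z\<close>. Testing monotonicity at the solution for the perturbed value
  \<open>y + t (x - z)\<close>, which depends on \<open>t\<close> in a Lipschitz way, excludes \<open>z \<noteq> x\<close> for small \<open>t\<close>.\<close>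

lemma maximal_in_of_solvable:
  fixes F :: "'a::real_inner \<Rightarrow> 'a set"
  assumes T: "strongly_monotone_graph \<kappa> (gph F \<inter> (U \<times> V))" and \<kappa>: "0 < \<kappa>" and V: "open V"
    and solv: "\<And>y. y \<in> V \<Longrightarrow> \<exists>x\<in>U. y \<in> F x"
  shows "maximal_in F (U \<times> V)"
  unfolding maximal_in_def
proof (intro allI impI equalityI subsetI)
  fix S p assume S: "monotone_op S \<and> gph F \<inter> U \<times> V \<subseteq> gph S" and p: "p \<in> gph S \<inter> U \<times> V"
  obtain x y where xy: "p = (x, y)" "y \<in> S x" "x \<in> U" "y \<in> V" using p by auto
  obtain z where z: "z \<in> U" "y \<in> F z" using solv xy by blast
  have "z = x"
  proof (rule ccontr)
    assume "z \<noteq> x"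
    define d where "d = x - z"
    have d: "0 < norm d" using \<open>z \<noteq> x\<close> by (simp add: d_def)
    obtain e where e: "0 < e" "ball y e \<subseteq> V" using V xy openE by blast
    define t where "t = min (\<kappa> / 2) (e / (2 * norm d))"
    have t: "0 < t" "t < \<kappa>" "t * norm d < e"
      using \<kappa> e d by (auto simp: t_def min_def field_simps)
    then have "y + t *\<^sub>R d \<in> V" using e by (auto simp: subset_iff dist_norm)
    then obtain z' where z': "z' \<in> U" "y + t *\<^sub>R d \<in> F z'" using solv by blast
    have "\<kappa> * (norm (z' - z))\<^sup>2 \<le> inner (t *\<^sub>R d) (z' - z)"
      using strongly_monotone_graphD[OF T, of z' "y + t *\<^sub>R d" z y] z z' xy \<open>y + t *\<^sub>R d \<in> V\<close> by simp
    from norm_le_of_strong_monotone[OF this]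
    have n: "\<kappa> * norm (z' - z) \<le> t * norm d" using t by simp
    have "0 \<le> inner (t *\<^sub>R d) (z' - x)"
      using monotone_graphD[of "gph S" z' "y + t *\<^sub>R d" x y] S z' xy \<open>y + t *\<^sub>R d \<in> V\<close>
      by (auto simp: monotone_op_def subset_iff)
    then have "0 \<le> inner d (z' - x)" using t by (simp add: zero_le_mult_iff)
    also have "\<dots> = inner d (z' - z) - norm d * norm d"
      by (simp add: d_def inner_diff power2_norm_eq_inner flip: power2_eq_square)
    finally have "norm d * norm d \<le> norm d * norm (z' - z)"
      using norm_cauchy_schwarz[of d "z' - z"] by linarith
    then have "norm d \<le> norm (z' - z)" using d by simp
    then have "\<kappa> * norm d \<le> t * norm d" using n \<kappa> by (smt (verit) mult_left_mono)
    then show False using d t by simp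
  qed
  then show "p \<in> gph F \<inter> U \<times> V" using xy z by simp
qed auto

text \<open>The difference quotients in the definition of the strict derivative join two points of the
  graph that are eventually in \<open>U \<times> V\<close>, so they inherit the strong monotonicity inequality.\<close>

lemma strict_lower_definite:
  assumes U: "nbhd U x" and V: "nbhd V y" and T: "strongly_monotone_graph \<kappa> (gph F \<inter> (U \<times> V))"
  shows "lower_definite_around (strict_graphical_derivative F) F \<kappa> x y"
  unfolding lower_definite_around_def
proof (intro exI conjI)
  let ?A = "interior U \<times> interior V"
  show "nbhd ?A (x, y)"
    using U V by (simp add: nbhd_def interior_open open_Times)
  show "\<forall>(x', y')\<in>?A \<inter> gph F. lower_definite \<kappa> (strict_graphical_derivative F x' y')"
    unfolding lower_definite_def
  proof clarify
    fix x' y' u v assume A: "x' \<in> interior U" "y' \<in> interior V"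
      and "(u, v) \<in> gph (strict_graphical_derivative F x' y')"
    then obtain xs ys s us vs where s: "\<And>k::nat. ys k \<in> F (xs k)" "xs \<longlonglongrightarrow> x'" "ys \<longlonglongrightarrow> y'"
      "\<And>k. 0 < s k" "s \<longlonglongrightarrow> 0" "us \<longlonglongrightarrow> u" "vs \<longlonglongrightarrow> v"
      "\<And>k. ys k + s k *\<^sub>R vs k \<in> F (xs k + s k *\<^sub>R us k)"
      unfolding strict_graphical_derivative_def mem_gph mem_Collect_eq by blast
    have l1: "(\<lambda>k. xs k + s k *\<^sub>R us k) \<longlonglongrightarrow> x' + 0 *\<^sub>R u"
      and l2: "(\<lambda>k. ys k + s k *\<^sub>R vs k) \<longlonglongrightarrow> y' + 0 *\<^sub>R v"
      by (intro tendsto_intros s)+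
    have ev: "\<forall>\<^sub>F k in sequentially. zs k \<in> W" if "zs \<longlonglongrightarrow> z" "z \<in> interior W"
      for zs :: "nat \<Rightarrow> 'a" and z W
      using topological_tendstoD[OF that(1) open_interior that(2)]
      by eventually_elim (use interior_subset in blast)
    have "\<forall>\<^sub>F k in sequentially. xs k + s k *\<^sub>R us k \<in> U"
      "\<forall>\<^sub>F k in sequentially. ys k + s k *\<^sub>R vs k \<in> V"
      using ev[OF l1, of U] ev[OF l2, of V] A by (simp_all)
    then have "\<forall>\<^sub>F k in sequentially. \<kappa> * (norm (us k))\<^sup>2 \<le> inner (us k) (vs k)"
      using ev[OF s(2) A(1)] ev[OF s(3) A(2)]
    proof eventually_elim
      case (elim k)
      then have "\<kappa> * (norm (s k *\<^sub>R us k))\<^sup>2 \<le> inner (s k *\<^sub>R vs k) (s k *\<^sub>R us k)"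
        using strongly_monotone_graphD[OF T, of "xs k + s k *\<^sub>R us k" "ys k + s k *\<^sub>R vs k" "xs k" "ys k"] s(1,8)
        by simp
      then have "(s k)\<^sup>2 * (\<kappa> * (norm (us k))\<^sup>2) \<le> (s k)\<^sup>2 * inner (us k) (vs k)"
        by (simp add: power_mult_distrib power2_eq_square inner_commute algebra_simps)
      then show ?case
        by (rule mult_left_le_imp_le) (use s(4)[of k] in simp)
    qed
    then show "\<kappa> * (norm u)\<^sup>2 \<le> inner u v"
      by (rule tendsto_le[OF sequentially_bot, rotated 2]) (intro tendsto_intros s)+
  qed
qed

lemma lower_definite_graphical_of_strict:
  assumes "lower_definite_around (strict_graphical_derivative F) F \<kappa> x y"
  shows "lower_definite_around (graphical_derivative F) F \<kappa> x y"
proof -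
  have "graphical_derivative F x' y' u \<subseteq> strict_graphical_derivative F x' y' u" if "y' \<in> F x'" for x' y' u
    unfolding graphical_derivative_def strict_graphical_derivative_def
  proof clarify
    fix v s us vs assume "\<forall>k::nat. 0 < s k" "s \<longlonglongrightarrow> 0" "us \<longlonglongrightarrow> u" "vs \<longlonglongrightarrow> v"
      "\<forall>k. (x' + s k *\<^sub>R us k, y' + s k *\<^sub>R vs k) \<in> gph F"
    then show "\<exists>xs ys s us vs. (\<forall>k::nat. (xs k, ys k) \<in> gph F) \<and> xs \<longlonglongrightarrow> x' \<and> ys \<longlonglongrightarrow> y' \<and>
      (\<forall>k. 0 < s k) \<and> s \<longlonglongrightarrow> 0 \<and> us \<longlonglongrightarrow> u \<and> vs \<longlonglongrightarrow> v \<and>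
      (\<forall>k. (xs k + s k *\<^sub>R us k, ys k + s k *\<^sub>R vs k) \<in> gph F)"
      using that by (intro exI[of _ "\<lambda>_. x'"] exI[of _ "\<lambda>_. y'"] exI[of _ s] exI[of _ us] exI[of _ vs]) simp
  qed
  then have "lower_definite \<kappa> (graphical_derivative F x' y')"
    if "lower_definite \<kappa> (strict_graphical_derivative F x' y')" "y' \<in> F x'" for x' y'
    using that by (auto simp: lower_definite_def gph_def subset_iff)
  then show ?thesis using assms unfolding lower_definite_around_def by fastforce
qed

text \<open>A single-valued Lipschitz localization of \<open>(F + \<mu> Id)\<^sup>-\<^sup>1\<close>, expressed without naming the inverse
  function and with a neighborhood of \<open>(x, y)\<close> in the graph of \<open>F\<close> rather than of \<open>F + \<mu> Id\<close>. It is
  the common consequence of the regularity parts of the equivalent conditions.\<close>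

definition lipschitz_resolvent_at ::
    "('a::real_inner \<Rightarrow> 'a set) \<Rightarrow> real \<Rightarrow> 'a \<Rightarrow> 'a \<Rightarrow> bool" where
  "lipschitz_resolvent_at F \<mu> x y \<longleftrightarrow>
     (\<exists>N r L. nbhd N (x, y) \<and> 0 < r \<and>
        (\<forall>w\<in>ball (y + \<mu> *\<^sub>R x) r. \<exists>(x', y')\<in>gph F \<inter> N. y' + \<mu> *\<^sub>R x' = w) \<and>
        (\<forall>(x1, y1)\<in>gph F \<inter> N. \<forall>(x2, y2)\<in>gph F \<inter> N.
           norm (x1 - x2) \<le> L * norm ((y1 + \<mu> *\<^sub>R x1) - (y2 + \<mu> *\<^sub>R x2))))"

lemma strongly_locally_maximal_of_solvable:
  assumes "nbhd U x" "open V" "y \<in> V" "0 < \<kappa>" "strongly_monotone_graph \<kappa> (gph F \<inter> (U \<times> V))"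
    and "\<And>y. y \<in> V \<Longrightarrow> \<exists>x\<in>U. y \<in> F x"
  shows "strongly_locally_maximal_monotone F \<kappa> x y"
proof -
  have "nbhd V y" using assms by (simp add: nbhd_def interior_open)
  moreover have "maximal_in F (U \<times> V)" using assms by (intro maximal_in_of_solvable)
  ultimately show ?thesis using assms unfolding strongly_locally_maximal_monotone_iff by blast
qed

text \<open>The shift \<open>\<rho> = 1\<close> serves as well as any other. Adding the identity keeps strong monotonicity, so
  only solvability has to be carried over to a box for the shifted graph; the fractions of \<open>a\<close>
  ensure that the box comes from points in \<open>U \<times> V\<close>.\<close>

lemma hypomonotone_of_strongly_monotone:
  fixes F :: "'a::{real_inner, complete_space} \<Rightarrow> 'a set"
  assumes sm: "strongly_locally_maximal_monotone F \<kappa> x y" and xy: "y \<in> F x" and \<kappa>: "0 < \<kappa>"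
  shows "locally_maximal_hypomonotone F x y"
proof -
  obtain U V where UV: "nbhd U x" "nbhd V y" "strongly_monotone_graph \<kappa> (gph F \<inter> (U \<times> V))"
    "maximal_in F (U \<times> V)"
    using sm unfolding strongly_locally_maximal_monotone_iff by blast
  obtain a where a: "0 < a" "ball x a \<subseteq> U" "ball y a \<subseteq> V"
  proof -
    obtain a1 a2 where "0 < a1" "ball x a1 \<subseteq> U" "0 < a2" "ball y a2 \<subseteq> V"
      using UV unfolding nbhd_iff_ball by blast
    then show ?thesis by (intro that[of "min a1 a2"]) auto
  qed
  let ?G = "plus_scaled_id F 1"
  obtain r where r: "0 < r" "\<And>w. w \<in> ball (y + 1 *\<^sub>R x) r \<Longrightarrow>
      \<exists>x'\<in>ball x (a / 4). \<exists>y'\<in>ball y (a / 4). y' \<in> F x' \<and> y' + 1 *\<^sub>R x' = w"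
    using resolvent_locally_solvable[OF xy UV, of 1 "a / 4"] \<kappa> a by auto
  define U' where "U' = ball x (a / 4)"
  define W where "W = ball (y + 1 *\<^sub>R x) (min r (a / 2))"
  have inV: "x' \<in> U" "w - x' \<in> V" if "x' \<in> U'" "w \<in> W" for x' w
  proof -
    have "norm (x' - x) < a / 4" "norm (w - (y + x)) < a / 2"
      using that by (auto simp: U'_def W_def dist_norm norm_minus_commute)
    moreover have "(w - x') - y = (w - (y + x)) - (x' - x)" by (simp add: algebra_simps)
    then have "norm ((w - x') - y) \<le> norm (w - (y + x)) + norm (x' - x)"
      using norm_triangle_ineq4 by metis
    ultimately have "norm (x' - x) < a" "norm ((w - x') - y) < a" using a(1) by linarith+
    then show "x' \<in> U" "w - x' \<in> V" using a by (auto simp: subset_iff dist_norm norm_minus_commute)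
  qed
  have sm1: "strongly_monotone_graph (\<kappa> + 1) (gph ?G \<inter> (U' \<times> W))"
    unfolding strongly_monotone_graph_def
  proof clarify
    fix x1 w1 x2 w2 assume *: "(x1, w1) \<in> gph ?G" "x1 \<in> U'" "w1 \<in> W" "(x2, w2) \<in> gph ?G" "x2 \<in> U'" "w2 \<in> W"
    have "\<kappa> * (norm (x1 - x2))\<^sup>2 \<le> inner ((w1 - x1) - (w2 - x2)) (x1 - x2)"
      using * inV by (intro strongly_monotone_graphD[OF UV(3)]) (auto simp: mem_plus_scaled_id)
    then show "(\<kappa> + 1) * (norm (x1 - x2))\<^sup>2 \<le> inner (w1 - w2) (x1 - x2)"
      by (simp add: power2_norm_eq_inner inner_diff inner_commute algebra_simps)
  qed
  have "strongly_locally_maximal_monotone ?G (\<kappa> + 1) x (y + 1 *\<^sub>R x)"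
  proof (rule strongly_locally_maximal_of_solvable[OF _ _ _ _ sm1])
    show "nbhd U' x" "open W" "y + 1 *\<^sub>R x \<in> W" "0 < \<kappa> + 1"
      using a r \<kappa> by (auto simp: U'_def W_def nbhd_def interior_open)
    show "\<exists>x'\<in>U'. w \<in> ?G x'" if "w \<in> W" for w
      using r(2)[of w] that unfolding U'_def W_def mem_plus_scaled_id by force
  qed
  then obtain U2 W2 where U2: "nbhd U2 x" "nbhd W2 (y + 1 *\<^sub>R x)"
    "strongly_monotone_graph (\<kappa> + 1) (gph ?G \<inter> (U2 \<times> W2))" "maximal_in ?G (U2 \<times> W2)"
    unfolding strongly_locally_maximal_monotone_iff by blast
  have "monotone_graph (gph ?G \<inter> (U2 \<times> W2))"
    unfolding monotone_graph_iff_strongly strongly_monotone_graph_def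
  proof clarify
    fix a b c d assume "(a, b) \<in> gph ?G" "a \<in> U2" "b \<in> W2" "(c, d) \<in> gph ?G" "c \<in> U2" "d \<in> W2"
    then have "(\<kappa> + 1) * (norm (a - c))\<^sup>2 \<le> inner (b - d) (a - c)"
      by (intro strongly_monotone_graphD[OF U2(3)]) auto
    moreover have "0 \<le> (\<kappa> + 1) * (norm (a - c))\<^sup>2" using \<kappa> by simp
    ultimately show "0 * (norm (a - c))\<^sup>2 \<le> inner (b - d) (a - c)" by simp
  qed
  then have "locally_maximal_monotone ?G x (y + 1 *\<^sub>R x)"
    unfolding locally_maximal_monotone_def using U2 by blast
  then show ?thesis unfolding locally_maximal_hypomonotone_def by (intro exI[of _ 1]) auto
qed

text \<open>A monotone \<open>F + \<rho> Id\<close> need not have a single-valued inverse, but adding one more identity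
  makes it strongly monotone with modulus one. This is why \<open>\<mu> = \<rho> + 1\<close>.\<close>

lemma lipschitz_resolvent_of_hypomonotone:
  fixes F :: "'a::{real_inner, complete_space} \<Rightarrow> 'a set"
  assumes hm: "locally_maximal_hypomonotone F x y" and xy: "y \<in> F x"
  shows "\<exists>\<mu>\<ge>0. lipschitz_resolvent_at F \<mu> x y"
proof -
  obtain \<rho> U W where \<rho>: "0 < \<rho>" and U: "nbhd U x" and W: "nbhd W (y + \<rho> *\<^sub>R x)"
    and mono: "monotone_graph (gph (plus_scaled_id F \<rho>) \<inter> (U \<times> W))"
    and max: "maximal_in (plus_scaled_id F \<rho>) (U \<times> W)"
    using hm unfolding locally_maximal_hypomonotone_def locally_maximal_monotone_def by blast
  let ?G = "plus_scaled_id F \<rho>"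
  obtain a b where a: "0 < a" "ball x a \<subseteq> U" and b: "0 < b" "ball (y + \<rho> *\<^sub>R x) b \<subseteq> W"
    using U W unfolding nbhd_iff_ball by blast
  obtain r where r: "0 < r" "\<And>w. w \<in> ball ((y + \<rho> *\<^sub>R x) + 1 *\<^sub>R x) r \<Longrightarrow>
      \<exists>x'\<in>ball x (min a b). \<exists>y'\<in>ball (y + \<rho> *\<^sub>R x) (min a b). y' \<in> ?G x' \<and> y' + 1 *\<^sub>R x' = w"
    using resolvent_locally_solvable[OF _ U W _ max, of 0 1 "min a b"] mono xy a b
    by (auto simp: monotone_graph_iff_strongly mem_plus_scaled_id)
  define N where "N = {(x', y'). x' \<in> U \<and> y' + \<rho> *\<^sub>R x' \<in> W}"
  have "nbhd N (x, y)"
  proof -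
    define e where "e = min a (b / (1 + \<rho>))"
    have e: "0 < e" "e \<le> a" "e + \<rho> * e \<le> b"
    proof -
      show "0 < e" "e \<le> a" using a b \<rho> by (auto simp: e_def)
      have "e \<le> b / (1 + \<rho>)" by (simp add: e_def)
      then show "e + \<rho> * e \<le> b" using \<rho> by (simp add: pos_le_divide_eq algebra_simps)
    qed
    have "ball x e \<times> ball y e \<subseteq> N"
    proof clarify
      fix x' y' assume "x' \<in> ball x e" "y' \<in> ball y e"
      then have *: "norm (x' - x) < e" "norm (y' - y) < e" by (auto simp: dist_norm norm_minus_commute)
      have "norm ((y' + \<rho> *\<^sub>R x') - (y + \<rho> *\<^sub>R x)) = norm ((y' - y) + \<rho> *\<^sub>R (x' - x))"
        by (simp add: algebra_simps)
      also have "\<dots> \<le> norm (y' - y) + \<rho> * norm (x' - x)"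
        by (rule order_trans[OF norm_triangle_ineq]) (use \<rho> in simp)
      also have "\<dots> < e + \<rho> * e" using * \<rho> by (intro add_strict_mono) auto
      finally have "norm ((y' + \<rho> *\<^sub>R x') - (y + \<rho> *\<^sub>R x)) < b" using e by simp
      moreover have "norm (x' - x) < a" using * e by simp
      ultimately show "(x', y') \<in> N"
        using a b by (auto simp: N_def subset_iff dist_norm norm_minus_commute)
    qed
    then show ?thesis using e(1) unfolding nbhd_Pair_iff_ball by blast
  qed
  moreover have "\<exists>(x', y')\<in>gph F \<inter> N. y' + (\<rho> + 1) *\<^sub>R x' = w" if "w \<in> ball (y + (\<rho> + 1) *\<^sub>R x) r" for w
  proof -
    have "w \<in> ball ((y + \<rho> *\<^sub>R x) + 1 *\<^sub>R x) r" using that by (simp add: algebra_simps)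
    from r(2)[OF this] obtain x' g where g: "x' \<in> ball x (min a b)" "g \<in> ball (y + \<rho> *\<^sub>R x) (min a b)" "g \<in> ?G x'" "g + 1 *\<^sub>R x' = w"
      by blast
    then have "x' \<in> U" "g \<in> W" using a b by auto
    then show ?thesis using g
      by (intro bexI[of _ "(x', g - \<rho> *\<^sub>R x')"]) (auto simp: N_def mem_plus_scaled_id algebra_simps)
  qed
  moreover have "norm (x1 - x2) \<le> 1 * norm ((y1 + (\<rho> + 1) *\<^sub>R x1) - (y2 + (\<rho> + 1) *\<^sub>R x2))"
    if "(x1, y1) \<in> gph F \<inter> N" "(x2, y2) \<in> gph F \<inter> N" for x1 y1 x2 y2
  proof -
    have "0 \<le> inner ((y1 + \<rho> *\<^sub>R x1) - (y2 + \<rho> *\<^sub>R x2)) (x1 - x2)"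
      using that by (intro monotone_graphD[OF mono]) (auto simp: N_def mem_plus_scaled_id)
    then have "1 * (norm (x1 - x2))\<^sup>2 \<le> inner ((y1 + (\<rho> + 1) *\<^sub>R x1) - (y2 + (\<rho> + 1) *\<^sub>R x2)) (x1 - x2)"
      by (simp add: power2_norm_eq_inner inner_diff inner_add inner_commute algebra_simps)
    from norm_le_of_strong_monotone[OF this] show ?thesis by simp
  qed
  ultimately have "lipschitz_resolvent_at F (\<rho> + 1) x y"
    unfolding lipschitz_resolvent_at_def using r(1)
    by (intro exI[of _ N] exI[of _ r] exI[of _ 1]) auto
  then show ?thesis using \<rho> by (intro exI[of _ "\<rho> + 1"]) auto
qed

lemma strongly_metrically_regularE:
  assumes "strongly_metrically_regular F x y"
  obtains U V \<theta> L where "nbhd U x" "nbhd V y" "\<theta> ` V \<subseteq> U" "L-lipschitz_on V \<theta>"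
    "\<forall>u v. u \<in> U \<and> v \<in> V \<and> v \<in> F u \<longleftrightarrow> v \<in> V \<and> u = \<theta> v"
proof -
  obtain U V \<theta> L where U: "nbhd U x" and V: "nbhd V y" and \<theta>: "\<theta> ` V \<subseteq> U" "L-lipschitz_on V \<theta>"
    and g: "gph (inv_map F) \<inter> (V \<times> U) = {(v, \<theta> v) | v. v \<in> V}"
    using assms unfolding strongly_metrically_regular_def
    by (elim exE conjE) (rule that; assumption)
  have "u \<in> U \<and> v \<in> V \<and> v \<in> F u \<longleftrightarrow> v \<in> V \<and> u = \<theta> v" for u v
  proof -
    have "u \<in> U \<and> v \<in> V \<and> v \<in> F u \<longleftrightarrow> (v, u) \<in> gph (inv_map F) \<inter> (V \<times> U)"
      by (auto simp: inv_map_def)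
    also have "\<dots> \<longleftrightarrow> v \<in> V \<and> u = \<theta> v" unfolding g by blast
    finally show ?thesis .
  qed
  then show thesis using that U V \<theta> by blast
qed

lemma lipschitz_resolvent_of_strongly_metrically_regular:
  assumes "strongly_metrically_regular F x y"
  shows "lipschitz_resolvent_at F 0 x y"
proof -
  obtain U V \<theta> L where U: "nbhd U x" and V: "nbhd V y" and \<theta>: "\<theta> ` V \<subseteq> U" "L-lipschitz_on V \<theta>"
    and iff0: "\<forall>u v. u \<in> U \<and> v \<in> V \<and> v \<in> F u \<longleftrightarrow> v \<in> V \<and> u = \<theta> v"
    using assms by (rule strongly_metrically_regularE)
  note iff = iff0[rule_format]
  obtain r where r: "0 < r" "ball y r \<subseteq> V" using V unfolding nbhd_iff_ball by blast
  have "nbhd (U \<times> V) (x, y)" using U V by (simp add: nbhd_def interior_Times)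
  moreover have "\<exists>(x', y')\<in>gph F \<inter> (U \<times> V). y' + 0 *\<^sub>R x' = w" if "w \<in> ball (y + 0 *\<^sub>R x) r" for w
    using that r iff[of "\<theta> w" w] by (intro bexI[of _ "(\<theta> w, w)"]) auto
  moreover have "norm (x1 - x2) \<le> L * norm ((y1 + 0 *\<^sub>R x1) - (y2 + 0 *\<^sub>R x2))"
    if "(x1, y1) \<in> gph F \<inter> (U \<times> V)" "(x2, y2) \<in> gph F \<inter> (U \<times> V)" for x1 y1 x2 y2
    using that iff[of x1 y1] iff[of x2 y2] lipschitz_onD[OF \<theta>(2), of y1 y2] by (auto simp: dist_norm)
  ultimately show ?thesis
    unfolding lipschitz_resolvent_at_def using r(1)
    by (intro exI[of _ "U \<times> V"] exI[of _ r] exI[of _ L]) auto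
qed

section \<open>From lower-definite derivatives to strong monotonicity\<close>

text \<open>The derivative condition first improves the Lipschitz inverse \<open>X\<close> of \<open>F + \<mu> Id\<close> to a cocoercive map
  with constant \<open>\<kappa> + \<mu>\<close>. Near the reference point, \<open>y' \<in> F x'\<close> is equivalent to the fixed point equation
  \<open>x' = X (y' + \<mu> x')\<close>, whose right-hand side contracts with factor \<open>\<mu> / (\<kappa> + \<mu>)\<close>.\<close>

lemma strongly_monotone_of_lipschitz_resolvent:
  fixes F :: "'a::{real_inner, complete_space} \<Rightarrow> 'a set"
  assumes res: "lipschitz_resolvent_at F \<mu> x y" and \<mu>: "0 \<le> \<mu>" and \<kappa>: "0 < \<kappa>" and xy: "y \<in> F x"
    and ld: "lower_definite_around (graphical_derivative F) F \<kappa> x y"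
  shows "strongly_locally_maximal_monotone F \<kappa> x y"
proof -
  define wbar where "wbar = y + \<mu> *\<^sub>R x"
  obtain N r L where N: "nbhd N (x, y)" and r: "0 < r"
    and ex: "\<And>w. w \<in> ball wbar r \<Longrightarrow> \<exists>(x', y')\<in>gph F \<inter> N. y' + \<mu> *\<^sub>R x' = w"
    and lip0: "\<And>x1 y1 x2 y2. (x1, y1) \<in> gph F \<inter> N \<Longrightarrow> (x2, y2) \<in> gph F \<inter> N \<Longrightarrow>
      norm (x1 - x2) \<le> L * norm ((y1 + \<mu> *\<^sub>R x1) - (y2 + \<mu> *\<^sub>R x2))"
    using res unfolding lipschitz_resolvent_at_def wbar_def by blast
  define K where "K = \<bar>L\<bar>"
  have lip: "norm (x1 - x2) \<le> K * norm ((y1 + \<mu> *\<^sub>R x1) - (y2 + \<mu> *\<^sub>R x2))"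
    if "(x1, y1) \<in> gph F \<inter> N" "(x2, y2) \<in> gph F \<inter> N" for x1 y1 x2 y2
    using lip0[OF that] mult_right_mono[OF abs_ge_self[of L] norm_ge_zero] unfolding K_def
    by (rule order_trans)
  have K: "0 \<le> K" by (simp add: K_def)
  have "\<exists>x'. (x', w - \<mu> *\<^sub>R x') \<in> gph F \<inter> N" if w: "w \<in> ball wbar r" for w
  proof -
    obtain x' y' where "(x', y') \<in> gph F \<inter> N" "y' + \<mu> *\<^sub>R x' = w" using ex[OF w] by auto
    then show ?thesis by (intro exI[of _ x']) auto
  qed
  then obtain X where X: "\<And>w. w \<in> ball wbar r \<Longrightarrow> (X w, w - \<mu> *\<^sub>R X w) \<in> gph F \<inter> N" by metis
  have X_lip: "norm (X w1 - X w2) \<le> K * norm (w1 - w2)" if "w1 \<in> ball wbar r" "w2 \<in> ball wbar r" for w1 w2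
    using lip[OF X[OF that(1)] X[OF that(2)]] by simp
  have X_eq: "x' = X (y' + \<mu> *\<^sub>R x')" if "(x', y') \<in> gph F \<inter> N" "y' + \<mu> *\<^sub>R x' \<in> ball wbar r" for x' y'
    using lip[OF that(1) X[OF that(2)]] by simp
  have xyN: "(x, y) \<in> gph F \<inter> N" using N xy interior_subset by (auto simp: nbhd_def)
  have X_bar: "X wbar = x" using X_eq[OF xyN] r by (simp add: wbar_def)
  obtain A where A: "nbhd A (x, y)"
    "\<And>x' y'. (x', y') \<in> A \<Longrightarrow> y' \<in> F x' \<Longrightarrow> lower_definite \<kappa> (graphical_derivative F x' y')"
    using ld unfolding lower_definite_around_def by (auto simp: gph_def)
  obtain a where a: "0 < a" "ball x a \<times> ball y a \<subseteq> A" using A(1) unfolding nbhd_Pair_iff_ball by blast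
  obtain b where b: "0 < b" "ball x b \<times> ball y b \<subseteq> N" using N unfolding nbhd_Pair_iff_ball by blast
  \<comment> \<open>On the ball of radius \<open>r1\<close> the graph points given by \<open>X\<close> stay where \<open>DF\<close> is lower-definite.\<close>
  define r1 where "r1 = min r (a / (1 + K + \<mu> * K))"
  have den: "0 < 1 + K + \<mu> * K" using K \<mu> by (simp add: add_pos_nonneg)
  have r1: "0 < r1" "r1 \<le> r" "(1 + K + \<mu> * K) * r1 \<le> a"
  proof -
    show "0 < r1" "r1 \<le> r" using r a den by (auto simp: r1_def)
    have "r1 \<le> a / (1 + K + \<mu> * K)" by (simp add: r1_def)
    then show "(1 + K + \<mu> * K) * r1 \<le> a" using den by (simp add: pos_le_divide_eq mult.commute)
  qed
  have sub: "w \<in> ball wbar r" if "w \<in> ball wbar r1" for w using that r1 by auto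
  have inA: "(X w, w - \<mu> *\<^sub>R X w) \<in> A" if "w \<in> ball wbar r1" for w
  proof -
    have w: "norm (w - wbar) < r1" using that by (simp add: dist_norm norm_minus_commute)
    have dX: "norm (X w - x) \<le> K * norm (w - wbar)"
      using X_lip[OF sub[OF that], of wbar] r by (simp add: X_bar)
    have eq: "(w - \<mu> *\<^sub>R X w) - y = (w - wbar) - \<mu> *\<^sub>R (X w - x)"
      by (simp add: wbar_def algebra_simps)
    have dY: "norm ((w - \<mu> *\<^sub>R X w) - y) \<le> norm (w - wbar) + \<mu> * norm (X w - x)"
      unfolding eq by (rule order_trans[OF norm_triangle_ineq4]) (use \<mu> in simp)
    have "\<mu> * norm (X w - x) \<le> \<mu> * (K * norm (w - wbar))"
      using dX \<mu> by (rule mult_left_mono)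
    moreover have "(1 + K + \<mu> * K) * norm (w - wbar) < (1 + K + \<mu> * K) * r1"
      using w den by simp
    then have "norm (w - wbar) + K * norm (w - wbar) + \<mu> * (K * norm (w - wbar)) < a"
      using r1(3) by (simp add: distrib_right mult.assoc)
    moreover have "0 \<le> K * norm (w - wbar)" "0 \<le> \<mu> * (K * norm (w - wbar))" "0 \<le> norm (w - wbar)"
      using K \<mu> by simp_all
    ultimately have "norm (X w - x) < a" "norm ((w - \<mu> *\<^sub>R X w) - y) < a" using dX dY by linarith+
    then show ?thesis using a(2) by (auto simp: subset_iff dist_norm norm_minus_commute)
  qed
  have coco: "(\<kappa> + \<mu>) * (norm (X w2 - X w1))\<^sup>2 \<le> inner (X w2 - X w1) (w2 - w1)"
    if w1: "w1 \<in> ball wbar r1" and w2: "w2 \<in> ball wbar r1" for w1 w2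
  proof -
    define d where "d = w2 - w1"
    define W where "W = (\<lambda>t::real. w1 + t *\<^sub>R d)"
    have W: "W t \<in> ball wbar r1" if "t \<in> {0..1}" for t
    proof -
      have "W t = (1 - t) *\<^sub>R w1 + t *\<^sub>R w2" by (simp add: W_def d_def algebra_simps)
      then show ?thesis using that convexD[OF convex_ball w1 w2, of "1 - t" t] by simp
    qed
    define f where "f = (\<lambda>t. X (W t))"
    have "(\<kappa> + \<mu>) * (norm (f 1 - f 0))\<^sup>2 \<le> inner (f 1 - f 0) d"
    proof (rule cocoercive_increment)
      show "(K * norm d)-lipschitz_on {0..1} f"
      proof (rule lipschitz_onI)
        fix s t :: real assume st: "s \<in> {0..1}" "t \<in> {0..1}"
        have "W s - W t = (s - t) *\<^sub>R d" by (simp add: W_def algebra_simps)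
        then show "dist (f s) (f t) \<le> K * norm d * dist s t"
          using X_lip[OF sub[OF W[OF st(1)]] sub[OF W[OF st(2)]]]
          by (simp add: f_def dist_norm ac_simps)
      qed (use K in simp)
      show "0 < \<kappa> + \<mu>" using \<kappa> \<mu> by simp
      fix t w \<sigma> s assume t: "t \<in> {0..1}" and \<sigma>: "\<sigma> \<in> {1, -1 :: real}" and s: "\<And>k::nat. 0 < s k"
        "\<And>k. t + \<sigma> * s k \<in> {0..1}" "s \<longlonglongrightarrow> 0"
        and lim: "(\<lambda>k. (f (t + \<sigma> * s k) - f t) /\<^sub>R s k) \<longlonglongrightarrow> \<sigma> *\<^sub>R w"
      \<comment> \<open>The curve \<open>(f, W - \<mu> f)\<close> runs in the graph of \<open>F\<close>, so its difference quotients in the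
        direction \<open>\<sigma>\<close> define an element of the graphical derivative.\<close>
      define us where "us = (\<lambda>k. (f (t + \<sigma> * s k) - f t) /\<^sub>R s k)"
      define vs where "vs = (\<lambda>k. \<sigma> *\<^sub>R d - \<mu> *\<^sub>R us k)"
      have inF: "W \<tau> - \<mu> *\<^sub>R f \<tau> \<in> F (f \<tau>)" if "\<tau> \<in> {0..1}" for \<tau>
        using X[OF sub[OF W[OF that]]] by (simp add: f_def)
      have u: "f t + s k *\<^sub>R us k = f (t + \<sigma> * s k)" for k
        using s(1)[of k] by (simp add: us_def)
      have v: "(W t - \<mu> *\<^sub>R f t) + s k *\<^sub>R vs k = W (t + \<sigma> * s k) - \<mu> *\<^sub>R f (t + \<sigma> * s k)" for k
        unfolding u[symmetric] by (simp add: vs_def W_def algebra_simps)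
      have "\<sigma> *\<^sub>R (d - \<mu> *\<^sub>R w) \<in> graphical_derivative F (f t) (W t - \<mu> *\<^sub>R f t) (\<sigma> *\<^sub>R w)"
        unfolding graphical_derivative_def
      proof (intro CollectI exI conjI allI)
        show "us \<longlonglongrightarrow> \<sigma> *\<^sub>R w" using lim by (simp add: us_def)
        then have "vs \<longlonglongrightarrow> \<sigma> *\<^sub>R d - \<mu> *\<^sub>R (\<sigma> *\<^sub>R w)" unfolding vs_def by (intro tendsto_intros)
        then show "vs \<longlonglongrightarrow> \<sigma> *\<^sub>R (d - \<mu> *\<^sub>R w)" by (simp add: algebra_simps)
        show "(f t + s k *\<^sub>R us k, W t - \<mu> *\<^sub>R f t + s k *\<^sub>R vs k) \<in> gph F" for k
          unfolding u v using inF[OF s(2)] by simp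
      qed (use s in auto)
      moreover have "lower_definite \<kappa> (graphical_derivative F (f t) (W t - \<mu> *\<^sub>R f t))"
        using A(2)[OF inA[OF W[OF t]]] inF[OF t] by (simp add: f_def)
      ultimately have "\<kappa> * (norm (\<sigma> *\<^sub>R w))\<^sup>2 \<le> inner (\<sigma> *\<^sub>R w) (\<sigma> *\<^sub>R (d - \<mu> *\<^sub>R w))"
        unfolding lower_definite_def gph_def by blast
      then show "(\<kappa> + \<mu>) * (norm w)\<^sup>2 \<le> inner w d"
        using \<sigma> by (auto simp: power2_norm_eq_inner inner_diff algebra_simps)
    qed
    then show ?thesis by (simp add: f_def W_def d_def)
  qed
  have X_contr: "(\<kappa> + \<mu>) * norm (X w2 - X w1) \<le> norm (w2 - w1)"
    if "w1 \<in> ball wbar r1" "w2 \<in> ball wbar r1" for w1 w2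
    using norm_le_of_strong_monotone coco[OF that] by (metis inner_commute)
  \<comment> \<open>The box \<open>U \<times> V\<close> below has to lie in \<open>N\<close> (radii below \<open>b\<close>) and be mapped by \<open>y' + \<mu> x'\<close> into
    the ball of radius \<open>r1\<close>. Radius \<open>\<kappa> e\<close> for \<open>V\<close> makes the contraction map \<open>U\<close> into itself.\<close>
  define e where "e = min (b / 2) (min (b / (2 * \<kappa>)) (r1 / (2 * (\<kappa> + \<mu>))))"
  have e: "0 < e" "e < b" "\<kappa> * e < b" "(\<kappa> + \<mu>) * e < r1"
  proof -
    show "0 < e" using b r1 \<kappa> \<mu> by (simp add: e_def add_pos_nonneg)
    have "e \<le> b / 2" "e \<le> b / (2 * \<kappa>)" "e \<le> r1 / (2 * (\<kappa> + \<mu>))"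
      unfolding e_def by linarith+
    then have "e \<le> b / 2" "\<kappa> * e \<le> b / 2" "(\<kappa> + \<mu>) * e \<le> r1 / 2"
      using \<kappa> \<mu> by (simp_all add: pos_le_divide_eq add_pos_nonneg mult.commute mult.left_commute)
    then show "e < b" "\<kappa> * e < b" "(\<kappa> + \<mu>) * e < r1" using b r1 by linarith+
  qed
  define U where "U = cball x e"
  define V where "V = ball y (\<kappa> * e)"
  have inW: "y' + \<mu> *\<^sub>R x' \<in> ball wbar r1" and nW: "norm (y' + \<mu> *\<^sub>R x' - wbar) \<le> (\<kappa> + \<mu>) * e"
    if "x' \<in> U" "y' \<in> V" for x' y'
  proof -
    have n: "norm (x' - x) \<le> e" "norm (y' - y) < \<kappa> * e"
      using that by (auto simp: U_def V_def dist_norm norm_minus_commute)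
    have eq: "y' + \<mu> *\<^sub>R x' - wbar = (y' - y) + \<mu> *\<^sub>R (x' - x)" by (simp add: wbar_def algebra_simps)
    have "norm (y' + \<mu> *\<^sub>R x' - wbar) \<le> norm (y' - y) + \<mu> * norm (x' - x)"
      unfolding eq by (rule order_trans[OF norm_triangle_ineq]) (use \<mu> in simp)
    also have "\<dots> \<le> \<kappa> * e + \<mu> * e" using n \<mu> by (intro add_mono mult_left_mono) auto
    finally show le: "norm (y' + \<mu> *\<^sub>R x' - wbar) \<le> (\<kappa> + \<mu>) * e" by (simp add: distrib_right)
    then show "y' + \<mu> *\<^sub>R x' \<in> ball wbar r1" using e by (simp add: dist_norm norm_minus_commute)
  qed
  have inN: "(x', y') \<in> N" if "x' \<in> U" "y' \<in> V" for x' y'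
    using that e b by (auto simp: U_def V_def subset_iff)
  have sm: "strongly_monotone_graph \<kappa> (gph F \<inter> (U \<times> V))"
    unfolding strongly_monotone_graph_def
  proof clarify
    fix x1 y1 x2 y2 assume p: "(x1, y1) \<in> gph F" "x1 \<in> U" "y1 \<in> V" "(x2, y2) \<in> gph F" "x2 \<in> U" "y2 \<in> V"
    have "x1 = X (y1 + \<mu> *\<^sub>R x1)" "x2 = X (y2 + \<mu> *\<^sub>R x2)"
      using p inN inW sub by (auto intro!: X_eq)
    then have "(\<kappa> + \<mu>) * (norm (x1 - x2))\<^sup>2 \<le> inner (x1 - x2) ((y1 + \<mu> *\<^sub>R x1) - (y2 + \<mu> *\<^sub>R x2))"
      using coco[OF inW[OF p(5,6)] inW[OF p(2,3)]] by simp
    then show "\<kappa> * (norm (x1 - x2))\<^sup>2 \<le> inner (y1 - y2) (x1 - x2)"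
      by (simp add: power2_norm_eq_inner inner_diff inner_add inner_commute algebra_simps)
  qed
  show ?thesis
  proof (rule strongly_locally_maximal_of_solvable[OF _ _ _ \<kappa> sm])
    show "nbhd U x" using e(1) unfolding nbhd_iff_ball U_def by (intro exI[of _ e]) auto
    show "open V" "y \<in> V" using e(1) \<kappa> by (auto simp: V_def)
    fix y' assume y': "y' \<in> V"
    have pos: "0 < \<kappa> + \<mu>" using \<kappa> \<mu> by simp
    define T where "T = (\<lambda>x'. X (y' + \<mu> *\<^sub>R x'))"
    have "\<exists>!x'\<in>U. T x' = x'"
    proof (rule Banach_fix)
      show "complete U" "U \<noteq> {}" using e(1)
        by (auto simp: U_def complete_eq_closed not_less)
      show "0 \<le> \<mu> / (\<kappa> + \<mu>)" "\<mu> / (\<kappa> + \<mu>) < 1" using \<kappa> \<mu> by auto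
      show "T ` U \<subseteq> U"
      proof clarify
        fix x' assume x': "x' \<in> U"
        have "(\<kappa> + \<mu>) * norm (T x' - x) \<le> norm (y' + \<mu> *\<^sub>R x' - wbar)"
          using X_contr[OF _ inW[OF x' y'], of wbar] r1(1) by (simp add: T_def X_bar)
        also have "\<dots> \<le> (\<kappa> + \<mu>) * e" by (rule nW[OF x' y'])
        finally have "norm (T x' - x) \<le> e" using pos by simp
        then show "T x' \<in> U" by (simp add: U_def dist_norm norm_minus_commute)
      qed
      fix x1 x2 assume p: "x1 \<in> U" "x2 \<in> U"
      have eq: "y' + \<mu> *\<^sub>R x1 - (y' + \<mu> *\<^sub>R x2) = \<mu> *\<^sub>R (x1 - x2)" by (simp add: algebra_simps)
      have "(\<kappa> + \<mu>) * norm (T x1 - T x2) \<le> \<mu> * norm (x1 - x2)"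
        using X_contr[OF inW[OF p(2) y'] inW[OF p(1) y'], unfolded eq] \<mu> by (simp add: T_def)
      then show "dist (T x1) (T x2) \<le> \<mu> / (\<kappa> + \<mu>) * dist x1 x2"
        using pos by (simp add: dist_norm pos_le_divide_eq mult.commute)
    qed
    then obtain x' where x': "x' \<in> U" "X (y' + \<mu> *\<^sub>R x') = x'" unfolding T_def by blast
    then have "y' \<in> F x'" using X[OF sub[OF inW[OF x'(1) y']]] by simp
    then show "\<exists>x\<in>U. y' \<in> F x" using x' by blast
  qed
qed

section \<open>Metric regularity and the finite-dimensional criterion\<close>

lemma strongly_metrically_regularI:
  assumes U: "nbhd U x" and V: "nbhd V y"
    and solv: "\<And>v. v \<in> V \<Longrightarrow> \<exists>u\<in>U. v \<in> F u"
    and lip: "\<And>u1 v1 u2 v2. u1 \<in> U \<Longrightarrow> v1 \<in> V \<Longrightarrow> v1 \<in> F u1 \<Longrightarrow> u2 \<in> U \<Longrightarrow> v2 \<in> V \<Longrightarrow> v2 \<in> F u2 \<Longrightarrow>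
      dist u1 u2 \<le> L * dist v1 v2" and L: "0 \<le> L"
  shows "strongly_metrically_regular F x y"
proof -
  obtain \<theta> where \<theta>: "\<And>v. v \<in> V \<Longrightarrow> \<theta> v \<in> U \<and> v \<in> F (\<theta> v)" using solv by metis
  have "gph (inv_map F) \<inter> (V \<times> U) = {(v, \<theta> v) | v. v \<in> V}"
  proof (intro equalityI subsetI)
    fix p assume "p \<in> gph (inv_map F) \<inter> (V \<times> U)"
    then obtain u v where p: "p = (v, u)" "u \<in> U" "v \<in> V" "v \<in> F u" by (auto simp: gph_def inv_map_def)
    then have "u = \<theta> v" using lip[of u v "\<theta> v" v] \<theta>[of v] by simp
    then show "p \<in> {(v, \<theta> v) | v. v \<in> V}" using p by blast
  qed (use \<theta> in \<open>auto simp: gph_def inv_map_def\<close>)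
  moreover have "L-lipschitz_on V \<theta>" using L lip \<theta> by (intro lipschitz_onI) auto
  moreover have "\<theta> ` V \<subseteq> U" using \<theta> by blast
  ultimately show ?thesis using U V unfolding strongly_metrically_regular_def by blast
qed

lemma strongly_metrically_regular_of_strongly_monotone:
  fixes F :: "'a::{real_inner, complete_space} \<Rightarrow> 'a set"
  assumes sm: "strongly_locally_maximal_monotone F \<kappa> x y" and xy: "y \<in> F x" and \<kappa>: "0 < \<kappa>"
  shows "strongly_metrically_regular F x y"
proof -
  obtain U V where UV: "nbhd U x" "nbhd V y" "strongly_monotone_graph \<kappa> (gph F \<inter> (U \<times> V))"
    "maximal_in F (U \<times> V)"
    using sm unfolding strongly_locally_maximal_monotone_iff by blast
  obtain a b where a: "0 < a" "ball x a \<subseteq> U" and b: "0 < b" "ball y b \<subseteq> V"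
    using UV unfolding nbhd_iff_ball by blast
  obtain r where r: "0 < r" "\<And>w. w \<in> ball (y + 0 *\<^sub>R x) r \<Longrightarrow>
      \<exists>x'\<in>ball x a. \<exists>y'\<in>ball y a. y' \<in> F x' \<and> y' + 0 *\<^sub>R x' = w"
    using resolvent_locally_solvable[OF xy UV, of 0 a] \<kappa> a by auto
  show ?thesis
  proof (rule strongly_metrically_regularI[of U _ "ball y (min r b)" _ _ "1 / \<kappa>"])
    show "nbhd U x" "nbhd (ball y (min r b)) y" "0 \<le> 1 / \<kappa>"
      using UV r b \<kappa> by (auto simp: nbhd_def interior_open)
    show "\<exists>u\<in>U. v \<in> F u" if "v \<in> ball y (min r b)" for v
      using r(2)[of v] that a by auto
    fix u1 v1 u2 v2 assume p: "u1 \<in> U" "v1 \<in> ball y (min r b)" "v1 \<in> F u1" "u2 \<in> U" "v2 \<in> ball y (min r b)" "v2 \<in> F u2"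
    have "\<kappa> * (norm (u1 - u2))\<^sup>2 \<le> inner (v1 - v2) (u1 - u2)"
      using p b by (intro strongly_monotone_graphD[OF UV(3)]) auto
    from norm_le_of_strong_monotone[OF this] show "dist u1 u2 \<le> 1 / \<kappa> * dist v1 v2"
      using \<kappa> by (simp add: dist_norm pos_le_divide_eq mult.commute)
  qed
qed

text \<open>Near \<open>(x, y)\<close> the graph is that of a continuous function of the second component, restricted to
  a closed box.\<close>

lemma closed_and_liminf_of_strongly_metrically_regular:
  fixes F :: "'a::metric_space \<Rightarrow> 'b::metric_space set"
  assumes smr: "strongly_metrically_regular F x y" and xy: "y \<in> F x"
  shows "locally_closed_at (gph F) (x, y)" and "x \<in> set_liminf (inv_map F) y"
proof -
  obtain U V \<theta> L where U: "nbhd U x" and V: "nbhd V y" and \<theta>: "\<theta> ` V \<subseteq> U" "L-lipschitz_on V \<theta>"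
    and iff0: "\<forall>u v. u \<in> U \<and> v \<in> V \<and> v \<in> F u \<longleftrightarrow> v \<in> V \<and> u = \<theta> v"
    using smr by (rule strongly_metrically_regularE)
  note iff = iff0[rule_format]
  obtain a where a: "0 < a" "cball x a \<subseteq> U" using U by (auto simp: nbhd_def mem_interior_cball)
  obtain b where b: "0 < b" "cball y b \<subseteq> V" using V by (auto simp: nbhd_def mem_interior_cball)
  have lim: "(\<lambda>n. \<theta> (vs n)) \<longlonglongrightarrow> \<theta> v" if "vs \<longlonglongrightarrow> v" "\<And>n. vs n \<in> V" "v \<in> V" for vs :: "nat \<Rightarrow> 'b" and v
    using continuous_on_tendsto_compose[OF lipschitz_on_continuous_on[OF \<theta>(2)] that(1,3)] that(2) by auto
  let ?N = "cball x a \<times> cball y b"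
  have "closed (gph F \<inter> ?N)"
    unfolding closed_sequential_limits
  proof (intro allI impI, elim conjE)
    fix p q assume p: "\<forall>n::nat. p n \<in> gph F \<inter> ?N" and "p \<longlonglongrightarrow> q"
    obtain u v where q: "q = (u, v)" by (cases q)
    have l1: "(\<lambda>n. fst (p n)) \<longlonglongrightarrow> u" and l2: "(\<lambda>n. snd (p n)) \<longlonglongrightarrow> v"
      using \<open>p \<longlonglongrightarrow> q\<close> q tendsto_fst tendsto_snd by force+
    have pn: "fst (p n) \<in> cball x a" "snd (p n) \<in> cball y b" "snd (p n) \<in> F (fst (p n))" for n
      using p by (auto simp: gph_def split_beta mem_Times_iff)
    have uv: "u \<in> cball x a" "v \<in> cball y b"
      using closed_sequentially[OF closed_cball _ l1] closed_sequentially[OF closed_cball _ l2] pn by auto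
    have "fst (p n) = \<theta> (snd (p n))" for n using pn[of n] iff a b by blast
    then have "(\<lambda>n. fst (p n)) \<longlonglongrightarrow> \<theta> v" using lim[OF l2] pn uv b by (simp add: subset_iff)
    then have "u = \<theta> v" using l1 LIMSEQ_unique by blast
    then have "v \<in> F u" using iff uv b by blast
    then show "q \<in> gph F \<inter> ?N" using q uv by simp
  qed
  moreover have "nbhd ?N (x, y)"
    unfolding nbhd_Pair_iff_ball using a b by (intro exI[of _ "min a b"]) auto
  ultimately show "locally_closed_at (gph F) (x, y)"
    unfolding locally_closed_at_def by (intro exI[of _ ?N]) (auto intro: closed_Times)
  show "x \<in> set_liminf (inv_map F) y"
    unfolding set_liminf_def
  proof (intro CollectI allI impI)
    fix ys assume ys: "ys \<longlonglongrightarrow> y"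
    obtain n0 where n0: "\<And>n. n0 \<le> n \<Longrightarrow> ys n \<in> V"
    proof -
      have "\<exists>n0. \<forall>n\<ge>n0. ys n \<in> ball y b"
        using topological_tendstoD[OF ys, of "ball y b"] b(1) unfolding eventually_sequentially by simp
      then show ?thesis using that b(2) ball_subset_cball by blast
    qed
    have "(\<lambda>k. \<theta> (ys (k + n0))) \<longlonglongrightarrow> \<theta> y"
      using LIMSEQ_ignore_initial_segment[OF ys, of n0] n0 b by (intro lim) auto
    moreover have "\<theta> y = x" using iff[of x y] xy a b by (auto simp: subset_iff)
    moreover have "\<theta> (ys (k + n0)) \<in> inv_map F (ys (k + n0))" for k
      using n0[of "k + n0"] iff by (auto simp: inv_map_def)
    ultimately show "\<exists>r xs. strict_mono (r :: nat \<Rightarrow> nat) \<and> xs \<longlonglongrightarrow> x \<and> (\<forall>k. xs k \<in> inv_map F (ys (r k)))"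
      by (intro exI[of _ "\<lambda>k. k + n0"] exI[of _ "\<lambda>k. \<theta> (ys (k + n0))"]) (auto simp: strict_mono_def)
  qed
qed

text \<open>The Bolzano-Weierstrass theorem for an inner product space with a finite spanning set. The
  coefficients with respect to an orthogonal spanning set are bounded. That set may contain zero;
  the corresponding coefficient is then zero as a quotient with denominator zero.\<close>

lemma finite_span_convergent_subsequence:
  fixes us :: "nat \<Rightarrow> 'a::real_inner"
  assumes B: "finite B" "span B = (UNIV :: 'a set)" and bd: "\<And>n. norm (us n) \<le> M"
  shows "\<exists>u r. strict_mono (r :: nat \<Rightarrow> nat) \<and> (us \<circ> r) \<longlonglongrightarrow> u"
proof -
  obtain C :: "'a set" where C: "finite C" "span C = UNIV" "pairwise orthogonal C"
    using basis_orthogonal[OF B(1)] B(2) by auto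
  have expand: "z = (\<Sum>c\<in>C. (inner z c / inner c c) *\<^sub>R c)" for z :: 'a
  proof -
    define d where "d = z - (\<Sum>c\<in>C. (inner z c / inner c c) *\<^sub>R c)"
    have "orthogonal d c" if c: "c \<in> C" for c
    proof -
      have "inner (\<Sum>b\<in>C. (inner z b / inner b b) *\<^sub>R b) c = (\<Sum>b\<in>C. inner z b / inner b b * inner b c)"
        by (simp add: inner_sum_left)
      also have "\<dots> = (\<Sum>b\<in>C. if b = c then inner z c else 0)"
        using C(3) c by (intro sum.cong) (auto simp: pairwise_def orthogonal_def)
      finally show ?thesis using C(1) c by (simp add: d_def orthogonal_def inner_diff_left)
    qed
    then have "orthogonal d d" using orthogonal_to_span[of d C d] C(2) by auto
    then show ?thesis by (simp add: d_def orthogonal_def)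
  qed
  have "\<exists>r. strict_mono (r :: nat \<Rightarrow> nat) \<and> (\<forall>c\<in>D. convergent (\<lambda>k. inner (us (r k)) c))" if "finite D" for D
    using that
  proof (induction D)
    case empty
    show ?case by (intro exI[of _ id]) (auto simp: strict_mono_def)
  next
    case (insert d D)
    then obtain r where r: "strict_mono (r :: nat \<Rightarrow> nat)" "\<forall>c\<in>D. convergent (\<lambda>k. inner (us (r k)) c)"
      by blast
    have "\<bar>inner (us (r k)) d\<bar> \<le> M * norm d" for k
      using Cauchy_Schwarz_ineq2[of "us (r k)" d] mult_right_mono[OF bd norm_ge_zero[of d]] by (rule order_trans)
    then have "bounded (range (\<lambda>k. inner (us (r k)) d))"
      unfolding bounded_iff by auto
    from bounded_imp_convergent_subsequence[OF this] obtain l q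
      where q: "strict_mono (q :: nat \<Rightarrow> nat)" "((\<lambda>k. inner (us (r k)) d) \<circ> q) \<longlonglongrightarrow> l" by blast
    have "convergent (\<lambda>k. inner (us ((r \<circ> q) k)) c)" if "c \<in> insert d D" for c
    proof (cases "c = d")
      case True
      then show ?thesis using q(2) by (auto simp: convergent_def o_def)
    next
      case False
      then have "convergent (\<lambda>k. inner (us (r k)) c)" using that r(2) by simp
      from convergent_subseq_convergent[OF this q(1)] show ?thesis by (simp add: o_def)
    qed
    then show ?case using strict_mono_o[OF r(1) q(1)] by blast
  qed
  from this[OF C(1)] obtain r where r: "strict_mono (r :: nat \<Rightarrow> nat)"
    "\<And>c. c \<in> C \<Longrightarrow> convergent (\<lambda>k. inner (us (r k)) c)" by blast
  then obtain l where l: "\<And>c. c \<in> C \<Longrightarrow> (\<lambda>k. inner (us (r k)) c) \<longlonglongrightarrow> l c"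
    unfolding convergent_def by metis
  have "(\<lambda>k. \<Sum>c\<in>C. (inner (us (r k)) c / inner c c) *\<^sub>R c) \<longlonglongrightarrow> (\<Sum>c\<in>C. (l c / inner c c) *\<^sub>R c)"
    by (intro tendsto_sum tendsto_scaleR tendsto_const)
      (auto simp: divide_inverse intro!: tendsto_mult l)
  then have "(us \<circ> r) \<longlonglongrightarrow> (\<Sum>c\<in>C. (l c / inner c c) *\<^sub>R c)"
    unfolding o_def expand[symmetric] .
  then show ?thesis using r(1) by blast
qed

text \<open>Otherwise there are pairs of graph points converging to \<open>(x, y)\<close> for which \<open>|x2 - x1|\<close> is
  arbitrarily large compared with \<open>|y2 - y1|\<close>. Normalizing by \<open>|x2 - x1|\<close> yields a unit vector \<open>u\<close>,
  by compactness, with \<open>0\<close> in the strict derivative at \<open>u\<close>, and lower-definiteness gives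
  \<open>\<kappa> \<le> 0\<close>.\<close>

lemma locally_lipschitz_inverse_of_strict:
  fixes F :: "'a::real_inner \<Rightarrow> 'a set"
  assumes B: "finite B" "span B = (UNIV :: 'a set)" and \<kappa>: "0 < \<kappa>" and xy: "y \<in> F x"
    and ld: "lower_definite_around (strict_graphical_derivative F) F \<kappa> x y"
  shows "\<exists>e>0. \<exists>L\<ge>0. \<forall>x1\<in>ball x e. \<forall>x2\<in>ball x e. \<forall>y1\<in>F x1 \<inter> ball y e. \<forall>y2\<in>F x2 \<inter> ball y e.
    dist x1 x2 \<le> L * dist y1 y2"
proof (rule ccontr)
  assume neg: "\<not> ?thesis"
  have "\<exists>x1 x2 y1 y2. x1 \<in> ball x (1 / Suc n) \<and> x2 \<in> ball x (1 / Suc n) \<and> y1 \<in> F x1 \<inter> ball y (1 / Suc n) \<and>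
    y2 \<in> F x2 \<inter> ball y (1 / Suc n) \<and> Suc n * dist y1 y2 < dist x1 x2" for n
  proof (rule ccontr)
    assume "\<not> ?thesis"
    then have "\<forall>x1\<in>ball x (1 / Suc n). \<forall>x2\<in>ball x (1 / Suc n). \<forall>y1\<in>F x1 \<inter> ball y (1 / Suc n).
      \<forall>y2\<in>F x2 \<inter> ball y (1 / Suc n). dist x1 x2 \<le> Suc n * dist y1 y2"
      by (meson not_less)
    then show False using neg
      by (metis of_nat_0_le_iff of_nat_0_less_iff zero_less_Suc zero_less_divide_1_iff)
  qed
  then obtain x1 x2 y1 y2 where p: "\<And>n. x1 n \<in> ball x (1 / Suc n)" "\<And>n. x2 n \<in> ball x (1 / Suc n)"
    "\<And>n. y1 n \<in> F (x1 n) \<inter> ball y (1 / Suc n)" "\<And>n. y2 n \<in> F (x2 n) \<inter> ball y (1 / Suc n)"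
    "\<And>n. Suc n * dist (y1 n) (y2 n) < dist (x1 n) (x2 n)"
    by metis
  have lim: "zs \<longlonglongrightarrow> z" if near: "\<And>n. zs n \<in> ball z (1 / Suc n)" for zs and z :: 'a
  proof (rule metric_LIMSEQ_I)
    fix r :: real assume "0 < r"
    then obtain n0 where n0: "inverse (real (Suc n0)) < r" using reals_Archimedean by blast
    have "dist (zs n) z < r" if "n0 \<le> n" for n
    proof -
      have "1 / real (Suc n) \<le> 1 / real (Suc n0)" using that by (intro divide_left_mono) auto
      moreover have "dist (zs n) z < 1 / real (Suc n)" using near[of n]
        by (simp add: dist_commute)
      ultimately show ?thesis using n0 by (simp add: inverse_eq_divide)
    qed
    then show "\<exists>no. \<forall>n\<ge>no. dist (zs n) z < r" by blast
  qed
  define s where "s = (\<lambda>n. norm (x2 n - x1 n))"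
  have s: "0 < s n" "norm (y2 n - y1 n) < s n / Suc n" for n
  proof -
    have *: "Suc n * norm (y2 n - y1 n) < s n"
      using p(5)[of n] by (simp add: s_def dist_norm norm_minus_commute)
    then show "norm (y2 n - y1 n) < s n / Suc n" by (simp add: pos_less_divide_eq mult.commute)
    have "0 \<le> Suc n * norm (y2 n - y1 n)" by simp
    with * show "0 < s n" by linarith
  qed
  define us where "us = (\<lambda>n. (x2 n - x1 n) /\<^sub>R s n)"
  define vs where "vs = (\<lambda>n. (y2 n - y1 n) /\<^sub>R s n)"
  have us1: "norm (us n) = 1" for n using s(1)[of n] by (simp add: us_def s_def)
  then have "norm (us n) \<le> 1" for n by simp
  from finite_span_convergent_subsequence[where us = us, OF B this]
  obtain u r where r: "strict_mono (r :: nat \<Rightarrow> nat)" "(us \<circ> r) \<longlonglongrightarrow> u" by blast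
  have "(\<lambda>n. norm ((us \<circ> r) n)) \<longlonglongrightarrow> norm u" by (intro tendsto_norm r)
  then have nu: "norm u = 1" using us1 LIMSEQ_unique[OF _ tendsto_const] by (simp add: o_def)
  have "s \<longlonglongrightarrow> norm (x - x)"
    unfolding s_def using lim[OF p(1)] lim[OF p(2)] by (intro tendsto_intros)
  then have s0: "s \<longlonglongrightarrow> 0" by simp
  have v0: "vs \<longlonglongrightarrow> 0"
  proof (rule Lim_null_comparison)
    have "norm (vs n) \<le> 1 / Suc n" for n
      using s[of n] by (simp add: vs_def divide_simps mult.commute)
    then show "\<forall>\<^sub>F n in sequentially. norm (vs n) \<le> 1 / Suc n" by simp
    show "(\<lambda>n. 1 / real (Suc n)) \<longlonglongrightarrow> 0" by (rule LIMSEQ_Suc[OF lim_1_over_n])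
  qed
  have "0 \<in> strict_graphical_derivative F x y u"
    unfolding strict_graphical_derivative_def
  proof (intro CollectI exI conjI allI)
    show "(x1 \<circ> r) \<longlonglongrightarrow> x" "(y1 \<circ> r) \<longlonglongrightarrow> y" "(s \<circ> r) \<longlonglongrightarrow> 0" "(us \<circ> r) \<longlonglongrightarrow> u" "(vs \<circ> r) \<longlonglongrightarrow> 0"
      using LIMSEQ_subseq_LIMSEQ[OF _ r(1)] lim[OF p(1)] lim[of y1 y] p(3) s0 v0 r(2) by auto
    show "((x1 \<circ> r) k, (y1 \<circ> r) k) \<in> gph F" "0 < (s \<circ> r) k" for k
      using p(3)[of "r k"] s(1)[of "r k"] by auto
    have "(x1 \<circ> r) k + (s \<circ> r) k *\<^sub>R (us \<circ> r) k = x2 (r k)" "(y1 \<circ> r) k + (s \<circ> r) k *\<^sub>R (vs \<circ> r) k = y2 (r k)" for k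
      using s(1)[of "r k"] by (auto simp: us_def vs_def)
    then show "((x1 \<circ> r) k + (s \<circ> r) k *\<^sub>R (us \<circ> r) k, (y1 \<circ> r) k + (s \<circ> r) k *\<^sub>R (vs \<circ> r) k) \<in> gph F" for k
      using p(4)[of "r k"] by simp
  qed
  moreover have "lower_definite \<kappa> (strict_graphical_derivative F x y)"
  proof -
    obtain A where A: "nbhd A (x, y)" "\<forall>(x', y')\<in>A \<inter> gph F. lower_definite \<kappa> (strict_graphical_derivative F x' y')"
      using ld unfolding lower_definite_around_def by blast
    have "(x, y) \<in> A \<inter> gph F" using A(1) xy interior_subset by (auto simp: nbhd_def)
    with A(2) show ?thesis by blast
  qed
  ultimately have "\<kappa> * (norm u)\<^sup>2 \<le> inner u 0"
    unfolding lower_definite_def gph_def by blast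
  then show False using nu \<kappa> by simp
qed

text \<open>Values \<open>y' \<rightarrow> y\<close> without a solution in a fixed ball around \<open>x\<close> would form a sequence no subsequence
  of which has solutions converging to \<open>x\<close>.\<close>

lemma locally_solvable_of_liminf:
  fixes F :: "'a::metric_space \<Rightarrow> 'b::metric_space set"
  assumes "x \<in> set_liminf (inv_map F) y" "0 < e"
  shows "\<exists>d>0. \<forall>y'\<in>ball y d. \<exists>x'\<in>ball x e. y' \<in> F x'"
proof (rule ccontr)
  assume neg: "\<not> ?thesis"
  have "\<exists>y'. y' \<in> ball y (1 / Suc n) \<and> (\<forall>x'\<in>ball x e. y' \<notin> F x')" for n
    using neg by (metis of_nat_0_less_iff zero_less_Suc zero_less_divide_1_iff)
  then obtain ys where ys: "\<And>n. ys n \<in> ball y (1 / Suc n)" "\<And>n x'. x' \<in> ball x e \<Longrightarrow> ys n \<notin> F x'" by metis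
  have "(\<lambda>n. dist (ys n) y) \<longlonglongrightarrow> 0"
  proof (rule tendsto_sandwich)
    show "(\<lambda>n. 0::real) \<longlonglongrightarrow> 0" "(\<lambda>n. 1 / real (Suc n)) \<longlonglongrightarrow> 0"
      by (rule tendsto_const, rule LIMSEQ_Suc[OF lim_1_over_n])
    show "\<forall>\<^sub>F n in sequentially. 0 \<le> dist (ys n) y" by simp
    show "\<forall>\<^sub>F n in sequentially. dist (ys n) y \<le> 1 / real (Suc n)"
      using ys(1) by (intro always_eventually) (auto simp: dist_commute less_imp_le)
  qed
  then have "ys \<longlonglongrightarrow> y" by (rule tendsto_dist_iff[THEN iffD2])
  then obtain r xs where r: "xs \<longlonglongrightarrow> x" "\<And>k. xs k \<in> inv_map F (ys (r k :: nat))"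
    using assms(1) unfolding set_liminf_def by blast
  obtain k where "xs k \<in> ball x e"
    using topological_tendstoD[OF r(1), of "ball x e"] assms(2) by (auto simp: eventually_sequentially)
  then show False using ys(2) r(2)[of k] by (auto simp: inv_map_def)
qed

theorem theorem3p2:
  fixes F :: "'a::{real_inner, complete_space} \<Rightarrow> 'a set"
    and xbar ybar :: 'a and \<kappa> :: real
  assumes "(xbar, ybar) \<in> gph F"
    and "\<kappa> > 0"
  shows "(strongly_locally_maximal_monotone F \<kappa> xbar ybar \<longleftrightarrow>
            lower_definite_around (graphical_derivative F) F \<kappa> xbar ybar \<and>
            locally_maximal_hypomonotone F xbar ybar) \<and>
         (strongly_locally_maximal_monotone F \<kappa> xbar ybar \<longleftrightarrow>
            lower_definite_around (graphical_derivative F) F \<kappa> xbar ybar \<and>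
            strongly_metrically_regular F xbar ybar) \<and>
         ((\<exists>B::'a set. finite B \<and> span B = UNIV) \<longrightarrow>
           (strongly_locally_maximal_monotone F \<kappa> xbar ybar \<longleftrightarrow>
              lower_definite_around (strict_graphical_derivative F) F \<kappa> xbar ybar \<and>
              locally_closed_at (gph F) (xbar, ybar) \<and>
              xbar \<in> set_liminf (inv_map F) ybar))"
proof -
  let ?a = "strongly_locally_maximal_monotone F \<kappa> xbar ybar"
  let ?D = "lower_definite_around (graphical_derivative F) F \<kappa> xbar ybar"
  let ?S = "lower_definite_around (strict_graphical_derivative F) F \<kappa> xbar ybar"
  have xy: "ybar \<in> F xbar" using assms(1) by simp
  note \<kappa> = assms(2)
  have strict: ?S if ?a
    using that strict_lower_definite unfolding strongly_locally_maximal_monotone_iff by blast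
  then have deriv: ?D if ?a
    using that lower_definite_graphical_of_strict by blast
  have regular: "strongly_metrically_regular F xbar ybar" if ?a
    using strongly_metrically_regular_of_strongly_monotone[OF that xy \<kappa>] .
  have of_regular: ?a if ?D "strongly_metrically_regular F xbar ybar"
    using strongly_monotone_of_lipschitz_resolvent[OF
        lipschitz_resolvent_of_strongly_metrically_regular[OF that(2)] order_refl \<kappa> xy that(1)] .
  have of_hypo: ?a if ?D "locally_maximal_hypomonotone F xbar ybar"
    using lipschitz_resolvent_of_hypomonotone[OF that(2) xy]
      strongly_monotone_of_lipschitz_resolvent[OF _ _ \<kappa> xy that(1)] by blast
  have of_strict: ?a if B: "finite B" "span B = (UNIV :: 'a set)" and "?S"
    and inv: "xbar \<in> set_liminf (inv_map F) ybar" for B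
  proof (rule of_regular)
    show ?D using \<open>?S\<close> by (rule lower_definite_graphical_of_strict)
    obtain e L where e: "0 < e" "0 \<le> L" "\<And>x1 x2 y1 y2. x1 \<in> ball xbar e \<Longrightarrow> x2 \<in> ball xbar e \<Longrightarrow>
      y1 \<in> F x1 \<Longrightarrow> y1 \<in> ball ybar e \<Longrightarrow> y2 \<in> F x2 \<Longrightarrow> y2 \<in> ball ybar e \<Longrightarrow> dist x1 x2 \<le> L * dist y1 y2"
      using locally_lipschitz_inverse_of_strict[OF B \<kappa> xy \<open>?S\<close>] by blast
    obtain d where d: "0 < d" "\<forall>y'\<in>ball ybar d. \<exists>x'\<in>ball xbar e. y' \<in> F x'"
      using locally_solvable_of_liminf[OF inv e(1)] by blast
    show "strongly_metrically_regular F xbar ybar"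
    proof (rule strongly_metrically_regularI[of "ball xbar e" _ "ball ybar (min d e)" _ _ L])
      show "nbhd (ball xbar e) xbar" "nbhd (ball ybar (min d e)) ybar" "0 \<le> L"
        using e d by (auto simp: nbhd_def interior_open)
    qed (use e d in auto)
  qed
  have hypo: "locally_maximal_hypomonotone F xbar ybar" if ?a
    using hypomonotone_of_strongly_monotone[OF that xy \<kappa>] .
  have closed_liminf: "locally_closed_at (gph F) (xbar, ybar) \<and> xbar \<in> set_liminf (inv_map F) ybar" if ?a
    using closed_and_liminf_of_strongly_metrically_regular[OF regular[OF that] xy] by simp
  show ?thesis
    using strict deriv regular hypo closed_liminf of_regular of_hypo of_strict by blast
qed

end
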